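(* Let $n\in\mathbb N$, $s\in(0,1)$, let $A$ be a Young function and let $\varphi_{s,A}:(0,\infty)\to(0,\infty)$ be defined by $$\varphi_{s,A}(r)=r^{s}A^{-1}(r^{-n})\qquad\text{for } r>0 .$$ (i) The embedding $V^{s,A}(\mathbb R^n)\to\mathcal L^{\varphi_{s,A}}(\mathbb R^n)$ holds, and there exists a constant $c=c(n,s)$ such that $$|u|_{\mathcal L^{\varphi_{s,A}}(\mathbb R^n)}\le c\,|u|_{s,A,\mathbb R^n}\qquad\text{for every } u\in V^{s,A}(\mathbb R^n).$$ Moreover, $\mathcal L^{\varphi_{s,A}}(\mathbb R^n)$ is the optimal (i.e. smallest) Campanato target space in this embedding and inequality: if $\varphi$ is an admissible function such that $V^{s,A}(\mathbb R^n)\to\mathcal L^{\varphi}(\mathbb R^n)$, then $\mathcal L^{\varphi_{s,A}}(\mathbb R^n)\to\mathcal L^{\varphi}(\mathbb R^n)$. (ii) Let $\varphi$ be an admissible function. Then $V^{s,A}(\mathbb R^n)\to V\!\mathcal L^{\varphi}(\mathbb R^n)$ uniformly if and only if both of the following hold: there is a positive constant $c$ such that $$\varphi_{s,A}(r)\le c\,\varphi(r)\qquad\text{for all } r>0,$$ and $$\lim_{r\to0^+}\frac{\varphi_{s,A}(r)}{\varphi(r)}=0 .$$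
   Context: A Young function is a convex, left-continuous function $A:[0,\infty)\to[0,\infty]$, non-constant in $(0,\infty)$, with $A(0)=0$. Its generalized right-continuous inverse is $A^{-1}(t)=\inf\{\tau\ge0: A(\tau)>t\}$. For $s\in(0,1)$ and a measurable $u:\mathbb R^n\to\mathbb R$, set $$J_{s,A}(u)=\int_{\mathbb R^n}\int_{\mathbb R^n}A\left(\frac{|u(x)-u(y)|}{|x-y|^s}\right)\frac{dx\,dy}{|x-y|^n},\qquad |u|_{s,A,\mathbb R^n}=\inf\{\lambda>0:\ J_{s,A}(u/\lambda)\le1\}.$$ The homogeneous fractional Orlicz–Sobolev space is $V^{s,A}(\mathbb R^n)=\{u\text{ measurable on }\mathbb R^n:\ |u|_{s,A,\mathbb R^n}<\infty\}$. A function $\varphi:(0,\infty)\to(0,\infty)$ is admissible if $\inf_{r\in[a,\infty)}\varphi(r)>0$ for every $a\in(0,\infty)$. The Campanato space $\mathcal L^{\varphi}(\mathbb R^n)$ consists of all $u\in L^1_{\rm loc}(\mathbb R^n)$ such that $$|u|_{\mathcal L^\varphi(\mathbb R^n)}=\sup_{B}\frac1{\varphi(|B|^{1/n})}\,\frac1{|B|}\int_B|u-u_B|\,dx<\infty,$$ where the supremum is over all balls $B\subset\mathbb R^n$, $|B|$ is the Lebesgue measure of $B$, and $u_B=\frac1{|B|}\int_Bu\,dx$. The same formulas define $|\cdot|_{\mathcal L^{\varphi_{s,A}}}$ and $\mathcal L^{\varphi_{s,A}}(\mathbb R^n)$. The vanishing Campanato space $V\!\mathcal L^\varphi(\mathbb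 R^n)$ is the set of $u\in\mathcal L^\varphi(\mathbb R^n)$ with $\lim_{r\to0^+}\sup_{|B|\le r}\frac1{\varphi(|B|^{1/n})}\frac1{|B|}\int_B|u-u_B|\,dx=0$. The arrow $\to$ denotes a continuous embedding, i.e. inclusion together with a bound of the target seminorm by a constant times the seminorm of the domain space. One says that $V^{s,A}(\mathbb R^n)\to V\!\mathcal L^\varphi(\mathbb R^n)$ uniformly if $V^{s,A}(\mathbb R^n)\to\mathcal L^\varphi(\mathbb R^n)$ and $$\lim_{r\to0^+}\ \sup_{|u|_{s,A,\mathbb R^n}\le1}\ \sup_{|B|\le r}\frac1{\varphi(|B|^{1/n})}\frac1{|B|}\int_B|u-u_B|\,dx=0,$$ where $B$ ranges over balls in $\mathbb R^n$. *)

theory Defs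
  imports "HOL-Analysis.Analysis"
begin

text \<open>
  Extended nonnegative quantities (values of Young functions, seminorms, suprema over balls)
  live in \<open>ennreal\<close>.  A Young function is only ever evaluated at nonnegative reals; its values at
  negative arguments are irrelevant.  In \<open>ennreal\<close> one has \<open>0 * \<infinity> = 0\<close>, so the convexity
  inequality is trivial at the endpoints \<open>t = 0\<close> and \<open>t = 1\<close>.
\<close>

definition young_function :: "(real \<Rightarrow> ennreal) \<Rightarrow> bool" where
  "young_function A \<longleftrightarrow>
     A 0 = 0 \<and>
     (\<forall>x\<ge>0. \<forall>y\<ge>0. \<forall>t\<in>{0..1}.
        A (t * x + (1 - t) * y) \<le> ennreal t * A x + ennreal (1 - t) * A y) \<and>
     (\<forall>x>0. continuous (at_left x) A) \<and>
     \<not> (\<exists>c. \<forall>x>0. A x = c)"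

text \<open>
  A Young function is unbounded on \<open>{0<..}\<close>, so the set below is nonempty and bounded below, and
  the real infimum is the genuine one.
\<close>

definition young_inverse :: "(real \<Rightarrow> ennreal) \<Rightarrow> real \<Rightarrow> real" where
  "young_inverse A t = Inf {\<tau>. 0 \<le> \<tau> \<and> ennreal t < A \<tau>}"

definition phi_sA :: "nat \<Rightarrow> real \<Rightarrow> (real \<Rightarrow> ennreal) \<Rightarrow> real \<Rightarrow> real" where
  "phi_sA n s A r = r powr s * young_inverse A (r powr (- real n))"

text \<open>
  ``Measurable'' means Lebesgue measurable.  On the (null) diagonal \<open>x = y\<close> the integrand of
  \<open>frac_modular\<close> is \<open>A 0 / 0 = 0 * \<infinity> = 0\<close>.
\<close>

definition frac_modular ::
    "real \<Rightarrow> (real \<Rightarrow> ennreal) \<Rightarrow> (real^'n \<Rightarrow> real) \<Rightarrow> ennreal" where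
  "frac_modular s A u =
     (\<integral>\<^sup>+ y. (\<integral>\<^sup>+ x. A (\<bar>u x - u y\<bar> / norm (x - y) powr s)
                    / ennreal (norm (x - y) ^ CARD('n)) \<partial>lebesgue) \<partial>lebesgue)"

text \<open>The infimum is taken in \<open>ennreal\<close>, so it is \<open>\<infinity>\<close> if no \<open>\<lambda>\<close> qualifies.\<close>

definition frac_seminorm ::
    "real \<Rightarrow> (real \<Rightarrow> ennreal) \<Rightarrow> (real^'n \<Rightarrow> real) \<Rightarrow> ennreal" where
  "frac_seminorm s A u =
     Inf {ennreal l | l. 0 < l \<and> frac_modular s A (\<lambda>x. u x / l) \<le> 1}"

definition frac_orlicz_sobolev ::
    "real \<Rightarrow> (real \<Rightarrow> ennreal) \<Rightarrow> (real^'n \<Rightarrow> real) set" where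
  "frac_orlicz_sobolev s A =
     {u. u \<in> borel_measurable lebesgue \<and> frac_seminorm s A u < \<infinity>}"

definition admissible :: "(real \<Rightarrow> real) \<Rightarrow> bool" where
  "admissible \<phi> \<longleftrightarrow> (\<forall>r>0. 0 < \<phi> r) \<and> (\<forall>a>0. 0 < (INF r\<in>{a..}. \<phi> r))"

definition balls :: "(real^'n) set set" where
  "balls = {ball x r | x r. 0 < r}"

definition average :: "(real^'n \<Rightarrow> real) \<Rightarrow> (real^'n) set \<Rightarrow> real" where
  "average u B = (LINT x:B|lebesgue. u x) / measure lebesgue B"

text \<open>
  For \<open>u\<close> integrable on \<open>B\<close> this is the usual quotient; if \<open>u\<close> is Lebesgue measurable but not
  integrable on \<open>B\<close>, then \<open>average u B = 0\<close> by the convention for Bochner integrals and the value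
  is \<open>\<infinity>\<close>.
\<close>

definition campanato_osc ::
    "(real \<Rightarrow> real) \<Rightarrow> (real^'n \<Rightarrow> real) \<Rightarrow> (real^'n) set \<Rightarrow> ennreal" where
  "campanato_osc \<phi> u B =
     ennreal (1 / \<phi> (measure lebesgue B powr (1 / real CARD('n))))
     * ennreal (1 / measure lebesgue B)
     * (\<integral>\<^sup>+ x\<in>B. ennreal \<bar>u x - average u B\<bar> \<partial>lebesgue)"

definition campanato_seminorm :: "(real \<Rightarrow> real) \<Rightarrow> (real^'n \<Rightarrow> real) \<Rightarrow> ennreal" where
  "campanato_seminorm \<phi> u = (SUP B\<in>balls. campanato_osc \<phi> u B)"

definition L1_loc :: "(real^'n \<Rightarrow> real) set" where
  "L1_loc = {u. \<forall>K. compact K \<longrightarrow> set_integrable lebesgue K u}"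

definition campanato :: "(real \<Rightarrow> real) \<Rightarrow> (real^'n \<Rightarrow> real) set" where
  "campanato \<phi> = {u \<in> L1_loc. campanato_seminorm \<phi> u < \<infinity>}"

definition continuously_embedded ::
    "'f set \<Rightarrow> ('f \<Rightarrow> ennreal) \<Rightarrow> 'f set \<Rightarrow> ('f \<Rightarrow> ennreal) \<Rightarrow> bool" where
  "continuously_embedded X p Y q \<longleftrightarrow>
     X \<subseteq> Y \<and> (\<exists>c::real. 0 < c \<and> (\<forall>u\<in>X. q u \<le> ennreal c * p u))"

text \<open>
  The dimension cannot be read off from the parameters \<open>s\<close>, \<open>A\<close>, \<open>\<phi>\<close>, hence the
  type argument below.
\<close>

definition sobolev_into_campanato ::
    "'n::finite itself \<Rightarrow> real \<Rightarrow> (real \<Rightarrow> ennreal) \<Rightarrow> (real \<Rightarrow> real) \<Rightarrow> bool" where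
  "sobolev_into_campanato (_ :: 'n itself) s A \<phi> \<longleftrightarrow>
     continuously_embedded
       (frac_orlicz_sobolev s A :: (real^'n \<Rightarrow> real) set) (frac_seminorm s A)
       (campanato \<phi>) (campanato_seminorm \<phi>)"

definition campanato_into_campanato ::
    "'n::finite itself \<Rightarrow> (real \<Rightarrow> real) \<Rightarrow> (real \<Rightarrow> real) \<Rightarrow> bool" where
  "campanato_into_campanato (_ :: 'n itself) \<psi> \<phi> \<longleftrightarrow>
     continuously_embedded
       (campanato \<psi> :: (real^'n \<Rightarrow> real) set) (campanato_seminorm \<psi>)
       (campanato \<phi>) (campanato_seminorm \<phi>)"

definition sobolev_into_vanishing_campanato_uniformly ::
    "'n::finite itself \<Rightarrow> real \<Rightarrow> (real \<Rightarrow> ennreal) \<Rightarrow> (real \<Rightarrow> real) \<Rightarrow> bool" where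
  "sobolev_into_vanishing_campanato_uniformly (_ :: 'n itself) s A \<phi> \<longleftrightarrow>
     sobolev_into_campanato TYPE('n) s A \<phi> \<and>
     ((\<lambda>r::real.
         SUP u\<in>{u \<in> frac_orlicz_sobolev s A :: (real^'n \<Rightarrow> real) set. frac_seminorm s A u \<le> 1}.
         SUP B\<in>{B \<in> balls. measure lebesgue B \<le> r}.
           campanato_osc \<phi> u B) \<longlongrightarrow> 0) (at_right 0)"

end

theory Submission
  imports Defs
begin

text \<open>
  Upper bound: if \<open>frac_modular s A (u / \<lambda>) \<le> 1\<close>, then some point \<open>y\<close> of a ball \<open>B\<close> of radius \<open>R\<close> has
  inner integral at most \<open>2 / |B|\<close>. Convexity makes \<open>A\<close> grow at least linearly beyond
  \<open>b = 2 * A\<^sup>-\<^sup>1(1 / |B|)\<close>, so this bounds the mean over \<open>B\<close> of \<open>|u x - u y|\<close> by a multiple of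
  \<open>\<lambda> (2 * R)\<^sup>s b\<close>; neither Jensen's inequality nor Fubini's theorem is needed.

  Sharpness: a multiple of the tent \<open>max 0 (1 - |x| / R)\<close> lies in the unit ball of the Sobolev
  seminorm and has mean oscillation comparable to \<open>\<phi>\<^sub>s\<^sub>A\<close> on the ball that supports it. Hence every
  embedding into a Campanato space with weight \<open>\<phi>\<close> is equivalent to a pointwise comparison of
  \<open>\<phi>\<^sub>s\<^sub>A\<close> with \<open>\<phi>\<close>.
\<close>

section \<open>Young functions and their generalized inverse\<close>

text \<open>Convexity between \<open>x\<close> and 0, where \<open>A\<close> vanishes. All later
  uses of convexity go through this inequality.\<close>

lemma young_function_scale:
  assumes "young_function A" "0 \<le> t" "t \<le> 1" "0 \<le> x"
  shows "A (t * x) \<le> ennreal t * A x"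
proof -
  have "A (t * x + (1 - t) * 0) \<le> ennreal t * A x + ennreal (1 - t) * A 0"
    using assms unfolding young_function_def by (metis atLeastAtMost_iff order_refl)
  then show ?thesis
    using assms(1) by (simp add: young_function_def)
qed

lemma young_function_mono:
  assumes "young_function A" "0 \<le> x" "x \<le> y"
  shows "A x \<le> A y"
proof (cases "y = 0")
  case True
  then show ?thesis using assms by simp
next
  case False
  then have y: "0 < y" using assms by simp
  have "A (x / y * y) \<le> ennreal (x / y) * A y"
    using assms y by (intro young_function_scale) auto
  also have "\<dots> \<le> 1 * A y"
    using assms y by (intro mult_right_mono) auto
  finally show ?thesis using y by simp
qed

text \<open>Since \<open>A\<close> is not constantly 0 on the positive axis, \<open>A x\<close> is
  at least some \<open>a > 0\<close> at some \<open>x > 0\<close>. Scaling then forces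
  \<open>A (k * x)\<close> to be at least \<open>k * a\<close> for \<open>k \<ge> 1\<close>. Hence
  the set in \<open>young_inverse\<close> is nonempty and its infimum is genuine.\<close>

lemma young_function_unbounded:
  assumes "young_function A"
  shows "\<exists>\<tau>\<ge>0. ennreal t < A \<tau>"
proof -
  obtain x where x: "0 < x" "A x \<noteq> 0"
    using assms unfolding young_function_def by metis
  obtain a where a: "0 < a" "ennreal a \<le> A x"
    using x(2) by (metis ennreal_less_zero_iff ennreal_enn2real_if ennreal_1 gr_zeroI
        linorder_not_less not_gr_zero order_refl top_greatest zero_less_one)
  define k where "k = max 1 ((\<bar>t\<bar> + 1) / a)"
  have k: "1 \<le> k" "\<bar>t\<bar> + 1 \<le> k * a"
    using a by (auto simp: k_def max_def field_simps)
  have "A (1 / k * (k * x)) \<le> ennreal (1 / k) * A (k * x)"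
    using k x assms by (intro young_function_scale) auto
  then have *: "ennreal a \<le> ennreal (1 / k) * A (k * x)"
    using k a by (auto intro: order_trans)
  have "ennreal k * ennreal a \<le> ennreal k * (ennreal (1 / k) * A (k * x))"
    using * by (intro mult_left_mono) auto
  also have "\<dots> = A (k * x)"
    using k by (simp add: mult.assoc[symmetric] ennreal_mult[symmetric])
  finally have "ennreal (k * a) \<le> A (k * x)"
    using k a by (simp add: ennreal_mult)
  moreover have "ennreal t < ennreal (k * a)"
    using k by (intro ennreal_lessI) auto
  ultimately show ?thesis
    using k x by (intro exI[of _ "k * x"]) auto
qed

text \<open>Since \<open>A\<close> is not constantly infinite on the positive axis either, it is
  finite at some \<open>x > 0\<close>. Shrinking to \<open>q * x\<close> brings the value down to at
  most \<open>t\<close>, so by monotonicity \<open>q * x\<close> is a positive lower bound of the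
  set in \<open>young_inverse\<close>.\<close>

lemma young_inverse_pos:
  assumes "young_function A" "0 < t"
  shows "0 < young_inverse A t"
proof -
  obtain x where x: "0 < x" "A x \<noteq> top"
    using assms(1) unfolding young_function_def by metis
  obtain a where a: "0 \<le> a" "A x = ennreal a"
    using x(2) by (cases "A x") auto
  \<comment> \<open>The denominator \<open>a + 1\<close> covers the case
    \<open>a = 0\<close>.\<close>
  define q where "q = min 1 (t / (a + 1))"
  have q: "0 < q" "q \<le> 1" "q * a \<le> t"
  proof -
    show "0 < q" "q \<le> 1" using a assms by (auto simp: q_def)
    have "q * a \<le> t / (a + 1) * a" using a by (intro mult_right_mono) (auto simp: q_def)
    also have "\<dots> \<le> t" using a assms by (auto simp: field_simps)
    finally show "q * a \<le> t" .
  qed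
  have le: "A (q * x) \<le> ennreal t"
    using young_function_scale[OF assms(1), of q x] q x a
    by (auto simp: ennreal_mult[symmetric] intro: order_trans ennreal_leI)
  have "q * x \<le> young_inverse A t"
    unfolding young_inverse_def
  proof (rule cInf_greatest)
    show "{\<tau>. 0 \<le> \<tau> \<and> ennreal t < A \<tau>} \<noteq> {}"
      using young_function_unbounded[OF assms(1)] by auto
    fix \<tau> assume "\<tau> \<in> {\<tau>. 0 \<le> \<tau> \<and> ennreal t < A \<tau>}"
    then have \<tau>: "0 \<le> \<tau>" "ennreal t < A \<tau>" by auto
    show "q * x \<le> \<tau>"
      using young_function_mono[OF assms(1) \<tau>(1), of "q * x"] \<tau>(2) le
      by (meson leD le_less_trans linear order_trans)
  qed
  then show ?thesis using q x by (meson less_le_trans mult_pos_pos)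
qed

lemma young_function_le_below_inverse:
  assumes "0 \<le> \<tau>" "\<tau> < young_inverse A t"
  shows "A \<tau> \<le> ennreal t"
proof (rule ccontr)
  assume "\<not> A \<tau> \<le> ennreal t"
  then have "young_inverse A t \<le> \<tau>"
    unfolding young_inverse_def using assms
    by (intro cInf_lower) (auto intro: bdd_belowI[of _ 0])
  then show False using assms by simp
qed

lemma young_function_gt_above_inverse:
  assumes "young_function A" "young_inverse A t < \<tau>"
  shows "ennreal t < A \<tau>"
proof -
  obtain \<sigma> where "0 \<le> \<sigma>" "ennreal t < A \<sigma>" "\<sigma> < \<tau>"
    using assms(2) young_function_unbounded[OF assms(1)] unfolding young_inverse_def
    by (subst (asm) cInf_less_iff) (auto intro: bdd_belowI[of _ 0])
  then show ?thesis
    using young_function_mono[OF assms(1), of \<sigma> \<tau>] by auto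
qed

lemma phi_sA_pos:
  assumes "young_function A" "0 < r"
  shows "0 < phi_sA n s A r"
  using assms by (simp add: phi_sA_def young_inverse_pos)

text \<open>Replaces Jensen's inequality: it controls the mean of \<open>w\<close> by that of \<open>A w\<close> without any
  measurability of \<open>A\<close>.\<close>

lemma young_function_linear_lower_bound:
  assumes "young_function A" "0 < b" "ennreal t < A b" "b \<le> w" "0 \<le> t"
  shows "ennreal (w * t / b) \<le> A w"
proof -
  have w: "0 < w" using assms by simp
  have "A (b / w * w) \<le> ennreal (b / w) * A w"
    using assms w by (intro young_function_scale) auto
  then have "ennreal t \<le> ennreal (b / w) * A w"
    using assms(3) w by auto
  then have "ennreal (w / b) * ennreal t \<le> ennreal (w / b) * (ennreal (b / w) * A w)"
    by (intro mult_left_mono) auto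
  also have "\<dots> = A w"
    using w assms by (simp add: mult.assoc[symmetric] ennreal_mult[symmetric])
  finally show ?thesis
    using w assms by (simp add: ennreal_mult[symmetric])
qed

section \<open>Mean deviation on a ball controlled by the modular\<close>

lemma measure_ball_real_vec:
  fixes z :: "real^'n"
  assumes "0 \<le> R"
  shows "measure lebesgue (ball z R) = unit_ball_vol (real CARD('n)) * R ^ CARD('n)"
    and "emeasure lebesgue (ball z R) = ennreal (measure lebesgue (ball z R))"
proof -
  show "measure lebesgue (ball z R) = unit_ball_vol (real CARD('n)) * R ^ CARD('n)"
    using content_ball[OF assms, of z] by simp
  show "emeasure lebesgue (ball z R) = ennreal (measure lebesgue (ball z R))"
    using emeasure_ball[OF assms, of z] content_ball[OF assms, of z] by simp
qed

lemma set_integrable_const_ball: "set_integrable lebesgue (ball (z::real^'n) R) (\<lambda>x. c::real)"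
  unfolding set_integrable_def
proof (intro integrable_scaleR_left impI)
  show "integrable lebesgue (indicat_real (ball z R))"
    using emeasure_lborel_ball_finite[of z R] by (intro integrable_real_indicator) auto
qed

text \<open>If \<open>G\<close> exceeded \<open>2 / m\<close> throughout \<open>B\<close>, its
  integral would be at least 2. The factor 2 leaves room for the contradiction, and comparison with
  a multiple of an indicator works for arbitrary \<open>G\<close>.\<close>

lemma exists_center_small_integral:
  assumes J: "(\<integral>\<^sup>+ y. G y \<partial>lebesgue) \<le> 1"
    and B: "B \<in> sets lebesgue" "emeasure lebesgue B = ennreal m" "0 < m"
  shows "\<exists>y\<in>B. G y \<le> ennreal (2 / m)"
proof (rule ccontr)
  assume "\<not> ?thesis"
  then have *: "ennreal (2 / m) \<le> G y" if "y \<in> B" for y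
    using that by force
  have "ennreal 2 = (\<integral>\<^sup>+ y. ennreal (2 / m) * indicator B y \<partial>lebesgue)"
    using B by (simp add: nn_integral_cmult_indicator ennreal_mult[symmetric] del: ennreal_numeral)
  also have "\<dots> \<le> (\<integral>\<^sup>+ y. G y \<partial>lebesgue)"
    using * by (intro nn_integral_mono) (auto split: split_indicator)
  also have "\<dots> \<le> ennreal 1" using J by simp
  finally show False by (subst (asm) ennreal_le_iff) auto
qed

text \<open>In the application \<open>d\<close> is the distance of two points of a ball,
  \<open>R\<close> its diameter and \<open>e\<close> the difference of the values of
  \<open>u\<close>. The threshold \<open>E\<close> is the value of \<open>e\<close> at which
  \<open>e / l / R powr s\<close> reaches \<open>b\<close>; from there on the linear lower bound for
  \<open>A\<close> is available. Replacing \<open>d\<close> by the larger \<open>R\<close> only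
  lowers the bound.\<close>

lemma modular_integrand_lower_bound:
  fixes d e E l R b t s :: real
  assumes A: "young_function A" and "0 < s" "0 < l" "0 < t" "0 < b" "ennreal t < A b"
    and d: "0 < d" "d \<le> R" and E: "E = l * R powr s * b" and e: "E \<le> e"
  shows "ennreal ((e - E) / (E * R ^ k / t)) \<le> A (e / l / d powr s) / ennreal (d ^ k)"
proof -
  have R: "0 < R" using d by simp
  have Epos: "0 < E" using assms R by simp
  have e0: "0 \<le> e" using e Epos by simp
  have ds: "d powr s \<le> R powr s" using d \<open>0 < s\<close> by (intro powr_mono2) auto
  define w where "w = e / l / d powr s"
  have w1: "b * e / E \<le> w"
  proof -
    have "b * e / E = e / l / R powr s" using E Epos assms by (simp add: field_simps)
    also have "\<dots> \<le> w" unfolding w_def using d ds e0 assms by (intro divide_left_mono) auto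
    finally show ?thesis .
  qed
  have "b * 1 \<le> b * (e / E)" using e Epos assms by (intro mult_left_mono) auto
  then have w2: "b \<le> w" using w1 by simp
  have "(e - E) / (E * R ^ k / t) \<le> (b * e / E) * t / b / R ^ k"
    using Epos assms R by (simp add: field_simps)
  also have "\<dots> \<le> w * t / b / R ^ k"
    using assms w1 R by (intro divide_right_mono mult_right_mono) auto
  also have "\<dots> \<le> w * t / b / d ^ k"
    using d assms w2 by (intro divide_left_mono power_mono) auto
  finally have "ennreal ((e - E) / (E * R ^ k / t)) \<le> ennreal (w * t / b / d ^ k)"
    by (rule ennreal_leI)
  also have "\<dots> = ennreal (w * t / b) / ennreal (d ^ k)"
    using d w2 assms by (intro divide_ennreal[symmetric]) auto
  also have "\<dots> \<le> A w / ennreal (d ^ k)"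
    using young_function_linear_lower_bound[OF A, of b t w] assms w2
    by (intro divide_right_mono_ennreal) auto
  finally show ?thesis by (simp add: w_def)
qed

text \<open>The constant is \<open>u y\<close> for a point \<open>y\<close> with small inner
  integral. Differences up to the threshold \<open>E\<close> contribute at most
  \<open>E * m\<close>. The excess over \<open>E\<close> is at most \<open>D\<close> times the
  modular integrand, which contributes \<open>D * (2 / m)\<close>, that is
  \<open>2 * E * (2 * R) ^ CARD('n)\<close>.\<close>

lemma modular_mean_deviation_bound:
  fixes u :: "real^'n \<Rightarrow> real" and z :: "real^'n"
  assumes A: "young_function A" and s: "0 < s"
    and u: "u \<in> borel_measurable lebesgue"
    and l: "0 < l" and J: "frac_modular s A (\<lambda>x. u x / l) \<le> 1" and R: "0 < R"
  defines "m \<equiv> measure lebesgue (ball z R)"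
  defines "E \<equiv> l * (2 * R) powr s * (2 * young_inverse A (1 / m))"
  shows "\<exists>c. (\<integral>\<^sup>+ x\<in>ball z R. ennreal \<bar>u x - c\<bar> \<partial>lebesgue)
              \<le> ennreal (E * m + 2 * E * (2 * R) ^ CARD('n))"
proof -
  let ?B = "ball z R"
  \<comment> \<open>Doubling the positive inverse moves strictly beyond it, where \<open>A\<close>
    exceeds \<open>1 / m\<close>.\<close>
  define b where "b = 2 * young_inverse A (1 / m)"
  have m: "0 < m" using R by (simp add: m_def)
  have inv: "0 < young_inverse A (1 / m)" using A m by (simp add: young_inverse_pos)
  then have b: "0 < b" "ennreal (1 / m) < A b"
    using young_function_gt_above_inverse[OF A, of "1 / m" b] by (auto simp: b_def)
  have E: "E = l * (2 * R) powr s * b" by (simp add: E_def b_def)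
  have Epos: "0 < E" using E b l R by simp
  define D where "D = E * (2 * R) ^ CARD('n) / (1 / m)"
  have D: "0 < D" using Epos R m by (simp add: D_def)
  let ?G = "\<lambda>y x. A (\<bar>u x / l - u y / l\<bar> / norm (x - y) powr s) / ennreal (norm (x - y) ^ CARD('n))"
  have em: "emeasure lebesgue ?B = ennreal m"
    unfolding m_def using R by (intro measure_ball_real_vec) auto
  obtain y where y: "y \<in> ?B" "(\<integral>\<^sup>+ x. ?G y x \<partial>lebesgue) \<le> ennreal (2 / m)"
    using exists_center_small_integral[OF J[unfolded frac_modular_def] _ em m] by auto
  \<comment> \<open>The excess over \<open>E\<close> is measurable, so it can be split off by
    \<open>nn_integral_add\<close>; \<open>?G y\<close> is reached from it by monotonicity
    alone.\<close>
  define F where "F x = max 0 (\<bar>u x - u y\<bar> - E)" for x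
  note [measurable] = u
  have [measurable]: "?B \<in> sets lebesgue" by simp
  have [measurable]: "F \<in> borel_measurable lebesgue" unfolding F_def by measurable
  have FG: "ennreal (F x / D) \<le> ?G y x" if x: "x \<in> ?B" for x
  proof (cases "E < \<bar>u x - u y\<bar>")
    case False
    then have "F x = 0" by (simp add: F_def)
    then show ?thesis by simp
  next
    case True
    then have "x \<noteq> y" using Epos by auto
    have "dist x y \<le> dist z x + dist z y" by (metis dist_triangle2 dist_commute)
    then have "norm (x - y) \<le> 2 * R" using x y(1) by (simp add: dist_norm)
    then have "ennreal ((\<bar>u x - u y\<bar> - E) / D)
        \<le> A (\<bar>u x - u y\<bar> / l / norm (x - y) powr s) / ennreal (norm (x - y) ^ CARD('n))"
      unfolding D_def using A s l m b E True \<open>x \<noteq> y\<close>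
      by (intro modular_integrand_lower_bound) auto
    moreover have "\<bar>u x - u y\<bar> / l = \<bar>u x / l - u y / l\<bar>"
      using l by (simp add: diff_divide_distrib[symmetric])
    ultimately show ?thesis using True by (simp add: F_def)
  qed
  have "(\<integral>\<^sup>+ x\<in>?B. ennreal \<bar>u x - u y\<bar> \<partial>lebesgue)
      \<le> (\<integral>\<^sup>+ x. ennreal E * indicator ?B x + ennreal D * (ennreal (F x / D) * indicator ?B x) \<partial>lebesgue)"
    using Epos D by (intro nn_integral_mono)
      (auto split: split_indicator simp: F_def ennreal_mult[symmetric] ennreal_plus[symmetric]
        simp del: ennreal_plus intro!: ennreal_leI)
  also have "\<dots> = (\<integral>\<^sup>+ x. ennreal E * indicator ?B x \<partial>lebesgue)
      + ennreal D * (\<integral>\<^sup>+ x. ennreal (F x / D) * indicator ?B x \<partial>lebesgue)"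
    by (subst nn_integral_add) (auto simp: nn_integral_cmult)
  also have "(\<integral>\<^sup>+ x. ennreal E * indicator ?B x \<partial>lebesgue) = ennreal (E * m)"
    using Epos m em by (simp add: nn_integral_cmult_indicator ennreal_mult)
  also have "ennreal (E * m) + ennreal D * (\<integral>\<^sup>+ x. ennreal (F x / D) * indicator ?B x \<partial>lebesgue)
      \<le> ennreal (E * m) + ennreal D * ennreal (2 / m)"
  proof (intro add_left_mono mult_left_mono)
    have "(\<integral>\<^sup>+ x. ennreal (F x / D) * indicator ?B x \<partial>lebesgue) \<le> (\<integral>\<^sup>+ x. ?G y x \<partial>lebesgue)"
      using FG by (intro nn_integral_mono) (auto split: split_indicator)
    also note y(2)
    finally show "(\<integral>\<^sup>+ x. ennreal (F x / D) * indicator ?B x \<partial>lebesgue) \<le> ennreal (2 / m)" .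
  qed simp
  also have "ennreal (E * m) + ennreal D * ennreal (2 / m)
      = ennreal (E * m + 2 * E * (2 * R) ^ CARD('n))"
    using Epos m D R by (simp add: ennreal_mult[symmetric] ennreal_plus[symmetric] D_def
        del: ennreal_plus)
  finally show ?thesis by blast
qed

lemma set_integrable_of_deviation:
  fixes u :: "real^'n \<Rightarrow> real"
  assumes u: "u \<in> borel_measurable lebesgue"
    and fin: "(\<integral>\<^sup>+ x\<in>ball z R. ennreal \<bar>u x - c\<bar> \<partial>lebesgue) < \<infinity>"
  shows "set_integrable lebesgue (ball z R) u"
proof -
  have c: "set_integrable lebesgue (ball z R) (\<lambda>x. c)"
    by (rule set_integrable_const_ball)
  have "set_integrable lebesgue (ball z R) (\<lambda>x. u x - c)"
    unfolding set_integrable_def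
  proof (rule integrableI_bounded)
    show "(\<lambda>x. indicat_real (ball z R) x *\<^sub>R (u x - c)) \<in> borel_measurable lebesgue"
    proof -
      note [measurable] = u
      have [measurable]: "ball z R \<in> sets lebesgue" by simp
      show ?thesis by measurable
    qed
    have "(\<integral>\<^sup>+ x. ennreal (norm (indicat_real (ball z R) x *\<^sub>R (u x - c))) \<partial>lebesgue)
        = (\<integral>\<^sup>+ x\<in>ball z R. ennreal \<bar>u x - c\<bar> \<partial>lebesgue)"
      by (intro nn_integral_cong) (auto split: split_indicator)
    then show "(\<integral>\<^sup>+ x. ennreal (norm (indicat_real (ball z R) x *\<^sub>R (u x - c))) \<partial>lebesgue) < \<infinity>"
      using fin by simp
  qed
  then have "set_integrable lebesgue (ball z R) (\<lambda>x. (u x - c) + c)"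
    using c by (rule set_integral_add)
  then show ?thesis by simp
qed

text \<open>The mean is an optimal constant up to a factor 2: integrating \<open>u - c\<close> over
  the ball bounds the distance of the mean from \<open>c\<close>, times the volume, by the deviation
  from \<open>c\<close>. The triangle inequality does the rest.\<close>

lemma deviation_from_average_le:
  fixes u :: "real^'n \<Rightarrow> real"
  assumes u: "u \<in> borel_measurable lebesgue" and R: "0 < R"
  shows "(\<integral>\<^sup>+ x\<in>ball z R. ennreal \<bar>u x - average u (ball z R)\<bar> \<partial>lebesgue)
         \<le> 2 * (\<integral>\<^sup>+ x\<in>ball z R. ennreal \<bar>u x - c\<bar> \<partial>lebesgue)"
    (is "_ \<le> 2 * ?I")
proof (cases "?I < \<infinity>")
  case False
  then show ?thesis by (simp add: ennreal_mult_top top_unique not_less)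
next
  case True
  let ?B = "ball z R" and ?a = "average u (ball z R)"
  note [measurable] = u
  have [measurable]: "?B \<in> sets lebesgue" by simp
  define m where "m = measure lebesgue ?B"
  have m: "0 < m" using R by (simp add: m_def)
  have em: "emeasure lebesgue ?B = ennreal m"
    unfolding m_def using R by (intro measure_ball_real_vec) auto
  \<comment> \<open>Finiteness of the deviation makes \<open>u\<close> integrable on the ball, so
    \<open>average\<close> is the true mean and not the default value 0.\<close>
  have int: "set_integrable lebesgue ?B u" by (rule set_integrable_of_deviation[OF u True])
  have c: "set_integrable lebesgue ?B (\<lambda>x. c)"
    by (rule set_integrable_const_ball)
  have "(LINT x:?B|lebesgue. u x - c) = (LINT x:?B|lebesgue. u x) - (LINT x:?B|lebesgue. c)"
    using int c by (rule set_integral_diff)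
  also have "(LINT x:?B|lebesgue. c) = m * c"
    by (simp add: set_lebesgue_integral_def m_def)
  also have "(LINT x:?B|lebesgue. u x) = m * ?a"
    using m by (simp add: average_def m_def)
  finally have "m * \<bar>?a - c\<bar> = \<bar>LINT x:?B|lebesgue. u x - c\<bar>"
    using m by (simp add: right_diff_distrib[symmetric] abs_mult)
  then have "ennreal (m * \<bar>?a - c\<bar>) = ennreal (norm (LINT x:?B|lebesgue. u x - c))"
    by simp
  also have "\<dots> \<le> (\<integral>\<^sup>+ x. ennreal (norm (indicat_real ?B x *\<^sub>R (u x - c))) \<partial>lebesgue)"
    unfolding set_lebesgue_integral_def
    using set_integral_diff(1)[OF int c] unfolding set_integrable_def
    by (rule integral_norm_bound_ennreal)
  also have "\<dots> = ?I"
    by (intro nn_integral_cong) (auto split: split_indicator)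
  finally have *: "ennreal (m * \<bar>?a - c\<bar>) \<le> ?I" .
  have "(\<integral>\<^sup>+ x\<in>?B. ennreal \<bar>u x - ?a\<bar> \<partial>lebesgue)
      \<le> (\<integral>\<^sup>+ x. ennreal \<bar>u x - c\<bar> * indicator ?B x + ennreal \<bar>?a - c\<bar> * indicator ?B x \<partial>lebesgue)"
    by (intro nn_integral_mono)
      (auto split: split_indicator simp: ennreal_plus[symmetric] simp del: ennreal_plus intro!: ennreal_leI)
  also have "\<dots> = ?I + (\<integral>\<^sup>+ x. ennreal \<bar>?a - c\<bar> * indicator ?B x \<partial>lebesgue)"
    by (subst nn_integral_add) auto
  also have "(\<integral>\<^sup>+ x. ennreal \<bar>?a - c\<bar> * indicator ?B x \<partial>lebesgue) = ennreal (m * \<bar>?a - c\<bar>)"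
    using em m by (simp add: nn_integral_cmult_indicator ennreal_mult[symmetric] mult.commute[of m])
  also note *
  also have "?I + ?I = 2 * ?I" by (simp add: mult_2)
  finally show ?thesis by (auto intro: add_left_mono)
qed

section \<open>A kernel bound independent of the radius\<close>

lemma between_consecutive_powers:
  fixes z :: real
  assumes "1 \<le> z"
  shows "\<exists>k. 2 ^ k \<le> z \<and> z < 2 ^ Suc k"
proof -
  have ex: "\<exists>k. z < 2 ^ k" by (rule real_arch_pow) simp
  define j where "j = (LEAST k. z < 2 ^ k)"
  have j: "z < 2 ^ j" unfolding j_def using ex by (rule LeastI_ex)
  then have "j \<noteq> 0" using assms by (cases j) auto
  then obtain k where k: "j = Suc k" by (cases j) auto
  have "\<not> z < 2 ^ k" using not_less_Least[of k "\<lambda>k. z < 2 ^ k"] k by (simp add: j_def)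
  then show ?thesis using j k by (intro exI[of _ k]) auto
qed

text \<open>Dyadic summation. Whole balls may replace disjoint shells, because the products of
  height \<open>c k\<close> and volume already form a geometric series.\<close>

lemma integral_le_geometric_ball_sum:
  fixes f :: "real^'n \<Rightarrow> ennreal" and y :: "real^'n"
  assumes f: "\<And>x. f x \<noteq> 0 \<Longrightarrow> \<exists>k. f x \<le> ennreal (c k) \<and> x \<in> cball y (\<rho> k)"
    and c: "\<And>k. 0 \<le> c k" "\<And>k. 0 \<le> \<rho> k"
    and q: "0 \<le> q" "q < 1" and W: "\<And>k. c k * (unit_ball_vol (real CARD('n)) * \<rho> k ^ CARD('n)) = W * q ^ k" "0 \<le> W"
  shows "(\<integral>\<^sup>+ x. f x \<partial>lebesgue) \<le> ennreal (W / (1 - q))"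
proof -
  have "(\<integral>\<^sup>+ x. f x \<partial>lebesgue)
      \<le> (\<integral>\<^sup>+ x. (\<Sum>k. ennreal (c k) * indicator (cball y (\<rho> k)) x) \<partial>lebesgue)"
  proof (rule nn_integral_mono)
    fix x
    show "f x \<le> (\<Sum>k. ennreal (c k) * indicator (cball y (\<rho> k)) x)"
    proof (cases "f x = 0")
      case False
      then obtain k where k: "f x \<le> ennreal (c k)" "x \<in> cball y (\<rho> k)" using f by blast
      have "f x \<le> (\<Sum>j\<in>{k}. ennreal (c j) * indicator (cball y (\<rho> j)) x)" using k by simp
      also have "\<dots> \<le> (\<Sum>k. ennreal (c k) * indicator (cball y (\<rho> k)) x)"
        by (intro sum_le_suminf) auto
      finally show ?thesis .
    qed simp
  qed
  also have "\<dots> = (\<Sum>k. \<integral>\<^sup>+ x. ennreal (c k) * indicator (cball y (\<rho> k)) x \<partial>lebesgue)"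
    by (intro nn_integral_suminf borel_measurable_times_ennreal borel_measurable_indicator) auto
  also have "\<dots> = (\<Sum>k. ennreal (W * q ^ k))"
  proof (rule suminf_cong)
    fix k
    have "emeasure lebesgue (cball y (\<rho> k)) = ennreal (unit_ball_vol (real CARD('n)) * \<rho> k ^ CARD('n))"
      using emeasure_cball[OF c(2), of y k] by simp
    then show "(\<integral>\<^sup>+ x. ennreal (c k) * indicator (cball y (\<rho> k)) x \<partial>lebesgue) = ennreal (W * q ^ k)"
      using c W by (simp add: nn_integral_cmult_indicator ennreal_mult[symmetric])
  qed
  also have "\<dots> = ennreal (W * (1 / (1 - q)))"
    using q W by (intro suminf_ennreal_eq sums_mult geometric_sums) auto
  finally show ?thesis by simp
qed

text \<open>Up to the factor \<open>A a\<close>, this dominates the modular integrand of \<open>a * R powr s\<close> times the tent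
  of radius \<open>R\<close>, with \<open>d = norm (x - y)\<close>. Its integral over \<open>x\<close> does not depend on \<open>R\<close>.\<close>

definition tent_kernel :: "nat \<Rightarrow> real \<Rightarrow> real \<Rightarrow> real \<Rightarrow> real" where
  "tent_kernel n s R d = min (d / R) 1 / (d / R) powr s / d ^ n"

text \<open>For distances up to \<open>R\<close> the numerator is
  \<open>(d / R) powr (1 - s)\<close>, which decays along the shells shrinking to 0 because
  \<open>s < 1\<close>. The denominator is bounded below at the inner radius of the shell.\<close>

lemma tent_kernel_near:
  assumes "0 < s" "s < 1" "0 < R" "R / 2 ^ Suc k \<le> d" "d \<le> R / 2 ^ k"
  shows "tent_kernel n s R d \<le> (2 powr (s - 1)) ^ k / (R / 2 ^ Suc k) ^ n"
proof -
  have d: "0 < d" using assms by (smt (verit) divide_pos_pos zero_less_power)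
  have "d / R \<le> 1 / 2 ^ k" using assms by (simp add: field_simps)
  moreover have "(1::real) / 2 ^ k \<le> 1" by simp
  ultimately have dR: "d / R \<le> 1 / 2 ^ k" "d / R \<le> 1" by linarith+
  have "min (d / R) 1 / (d / R) powr s = (d / R) powr (1 - s)"
    using d assms dR by (simp add: powr_diff min_def)
  also have "\<dots> \<le> (1 / 2 ^ k) powr (1 - s)"
    using d assms dR by (intro powr_mono2) auto
  also have "\<dots> = (2 powr (s - 1)) ^ k"
    by (simp add: powr_realpow[symmetric] powr_powr powr_divide powr_minus_divide[symmetric] algebra_simps)
  finally show ?thesis unfolding tent_kernel_def
    using d assms by (intro frac_le power_mono) auto
qed

text \<open>Beyond \<open>R\<close> the minimum is 1, leaving \<open>(d / R) powr (- s)\<close>,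
  which decays along the growing shells because \<open>s > 0\<close>.\<close>

lemma tent_kernel_far:
  assumes "0 < s" "s < 1" "0 < R" "R * 2 ^ k \<le> d"
  shows "tent_kernel n s R d \<le> (2 powr (- s)) ^ k / (R * 2 ^ k) ^ n"
proof -
  have d: "0 < d" using assms by (smt (verit) mult_pos_pos zero_less_power)
  have "2 ^ k \<le> d / R" using assms by (simp add: field_simps)
  moreover have "(1::real) \<le> 2 ^ k" by simp
  ultimately have dR: "2 ^ k \<le> d / R" "1 \<le> d / R" by linarith+
  have "min (d / R) 1 / (d / R) powr s = (d / R) powr (- s)"
    using d assms dR by (simp add: powr_minus_divide)
  also have "\<dots> \<le> (2 ^ k) powr (- s)"
    using d assms dR by (intro powr_mono2') auto
  also have "\<dots> = (2 powr (- s)) ^ k"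
    by (simp add: powr_realpow[symmetric] powr_powr algebra_simps)
  finally show ?thesis unfolding tent_kernel_def
    using d assms by (intro frac_le power_mono) auto
qed

text \<open>Split at distance \<open>R\<close> and sum over dyadic shells on either side, with
  ratios \<open>q1\<close> and \<open>q2\<close>. Only the ratio of outer to inner radius of a shell
  enters the volume factors, so \<open>R\<close> cancels.\<close>

lemma tent_kernel_integral_bound:
  assumes s: "0 < s" "s < 1"
  shows "\<exists>\<kappa>>0. \<forall>R>0. \<forall>y::real^'n.
    (\<integral>\<^sup>+ x. ennreal (tent_kernel CARD('n) s R (norm (x - y))) \<partial>lebesgue) \<le> ennreal \<kappa>"
proof -
  let ?n = "CARD('n)"
  \<comment> \<open>Volume of the outer ball of a shell divided by the \<open>CARD('n)\<close>-th
    power of its inner radius, the radii having ratio 2.\<close>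
  define W where "W = unit_ball_vol (real ?n) * 2 ^ ?n"
  have W: "0 < W" by (simp add: W_def)
  define q1 :: real where "q1 = 2 powr (s - 1)"
  define q2 :: real where "q2 = 2 powr (- s)"
  have q: "0 < q1" "q1 < 1" "0 < q2" "q2 < 1"
    using s powr_less_mono[of "s - 1" 0 2] powr_less_mono[of "- s" 0 2] by (auto simp: q1_def q2_def)
  define \<kappa> where "\<kappa> = W / (1 - q1) + W / (1 - q2)"
  have "(\<integral>\<^sup>+ x. ennreal (tent_kernel ?n s R (norm (x - y))) \<partial>lebesgue) \<le> ennreal \<kappa>"
    if R: "0 < R" for R and y :: "real^'n"
  proof -
    let ?f = "\<lambda>x. ennreal (tent_kernel ?n s R (norm (x - y)))"
    let ?B = "cball y R"
    have near: "(\<integral>\<^sup>+ x. ?f x * indicator ?B x \<partial>lebesgue) \<le> ennreal (W / (1 - q1))"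
    proof (rule integral_le_geometric_ball_sum[where c = "\<lambda>k. q1 ^ k / (R / 2 ^ Suc k) ^ ?n" and \<rho> = "\<lambda>k. R / 2 ^ k" and y = y])
      fix x assume "?f x * indicator ?B x \<noteq> 0"
      \<comment> \<open>The kernel is 0 at distance 0, so the nonvanishing of the integrand excludes
        \<open>x = y\<close>.\<close>
      then have x: "norm (x - y) \<le> R" "x \<noteq> y"
        by (auto simp: tent_kernel_def indicator_def dist_norm norm_minus_commute split: if_splits)
      then have "1 \<le> R / norm (x - y)" by simp
      then obtain k where k: "2 ^ k \<le> R / norm (x - y)" "R / norm (x - y) < 2 ^ Suc k"
        using between_consecutive_powers by blast
      have k': "norm (x - y) \<le> R / 2 ^ k" "R / 2 ^ Suc k \<le> norm (x - y)"
        using k x by (auto simp: field_simps)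
      show "\<exists>k. ?f x * indicator ?B x \<le> ennreal (q1 ^ k / (R / 2 ^ Suc k) ^ ?n) \<and> x \<in> cball y (R / 2 ^ k)"
        using tent_kernel_near[OF s R k'(2,1), of ?n] x k'
        by (intro exI[of _ k]) (auto simp: q1_def dist_norm norm_minus_commute intro!: ennreal_leI)
    next
      fix k
      show "q1 ^ k / (R / 2 ^ Suc k) ^ ?n * (unit_ball_vol (real ?n) * (R / 2 ^ k) ^ ?n) = W * q1 ^ k"
        using R by (simp add: W_def field_simps)
    qed (use q R W in auto)
    have far: "(\<integral>\<^sup>+ x. ?f x * indicator (- ?B) x \<partial>lebesgue) \<le> ennreal (W / (1 - q2))"
    proof (rule integral_le_geometric_ball_sum[where c = "\<lambda>k. q2 ^ k / (R * 2 ^ k) ^ ?n" and \<rho> = "\<lambda>k. R * 2 ^ Suc k" and y = y])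
      fix x assume "?f x * indicator (- ?B) x \<noteq> 0"
      then have x: "R < norm (x - y)"
        by (auto simp: indicator_def dist_norm norm_minus_commute split: if_splits)
      then have "1 \<le> norm (x - y) / R" using R by simp
      then obtain k where k: "2 ^ k \<le> norm (x - y) / R" "norm (x - y) / R < 2 ^ Suc k"
        using between_consecutive_powers by blast
      have k': "norm (x - y) \<le> R * 2 ^ Suc k" "R * 2 ^ k \<le> norm (x - y)"
        using k R by (auto simp: field_simps)
      show "\<exists>k. ?f x * indicator (- ?B) x \<le> ennreal (q2 ^ k / (R * 2 ^ k) ^ ?n) \<and> x \<in> cball y (R * 2 ^ Suc k)"
        using tent_kernel_far[OF s R k'(2), of ?n] x k'
        by (intro exI[of _ k]) (auto simp: q2_def dist_norm norm_minus_commute intro!: ennreal_leI)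
    next
      fix k
      show "q2 ^ k / (R * 2 ^ k) ^ ?n * (unit_ball_vol (real ?n) * (R * 2 ^ Suc k) ^ ?n) = W * q2 ^ k"
        using R by (simp add: W_def field_simps)
    qed (use q R W in auto)
    have f: "?f \<in> borel_measurable lebesgue"
      unfolding tent_kernel_def by (intro measurable_completion) measurable
    have "(\<integral>\<^sup>+ x. ?f x \<partial>lebesgue)
        = (\<integral>\<^sup>+ x. ?f x * indicator ?B x + ?f x * indicator (- ?B) x \<partial>lebesgue)"
      by (intro nn_integral_cong) (auto split: split_indicator)
    also have "\<dots> = (\<integral>\<^sup>+ x. ?f x * indicator ?B x \<partial>lebesgue) + (\<integral>\<^sup>+ x. ?f x * indicator (- ?B) x \<partial>lebesgue)"
      by (intro nn_integral_add borel_measurable_times_ennreal f borel_measurable_indicator) auto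
    also have "\<dots> \<le> ennreal (W / (1 - q1)) + ennreal (W / (1 - q2))"
      by (intro add_mono near far)
    also have "\<dots> = ennreal \<kappa>" using W q by (simp add: \<kappa>_def ennreal_plus)
    finally show ?thesis .
  qed
  moreover have "0 < \<kappa>" using W q by (simp add: \<kappa>_def add_pos_pos)
  ultimately show ?thesis by blast
qed

section \<open>The modular and the mean deviation of a scaled tent\<close>

definition tent :: "real \<Rightarrow> (real^'n) \<Rightarrow> real" where
  "tent R x = max 0 (1 - norm x / R)"

text \<open>The tent is Lipschitz with constant \<open>1 / R\<close> and takes its values between 0
  and 1.\<close>

lemma tent_diff_le:
  assumes "0 < R"
  shows "\<bar>tent R x - tent R y\<bar> \<le> min (norm (x - y) / R) 1"
proof -
  have "\<bar>norm x / R - norm y / R\<bar> = \<bar>norm x - norm y\<bar> / R"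
    using assms by (simp add: diff_divide_distrib[symmetric])
  also have "\<dots> \<le> norm (x - y) / R"
    using assms by (intro divide_right_mono norm_triangle_ineq3) auto
  finally have "\<bar>norm x / R - norm y / R\<bar> \<le> norm (x - y) / R" .
  moreover have "0 \<le> norm x / R" "0 \<le> norm y / R" using assms by auto
  ultimately show ?thesis unfolding tent_def by (simp add: max_def min_def abs_if split: if_splits)
qed

lemma tent_eq_0:
  assumes "0 < R" "x \<notin> ball 0 R"
  shows "tent R x = 0"
  using assms by (simp add: tent_def max_def field_simps)

text \<open>If the points coincide or both lie outside the ball, the left side is 0. Otherwise the
  argument of \<open>A\<close> is at most \<open>?m * a\<close> with \<open>?m\<close> between 0 and
  1, so scaling gives \<open>A (?m * a) \<le> ?m * A a\<close>, and the sum of indicators is at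
  least 1. The factor \<open>R powr s\<close> makes the argument depend on
  \<open>norm (x - y) / R\<close> only.\<close>

lemma tent_modular_integrand_le:
  fixes x y :: "real^'n"
  assumes A: "young_function A" and s: "0 < s" "s < 1" and R: "0 < R" and a: "0 \<le> a"
  shows "A (\<bar>a * R powr s * tent R x - a * R powr s * tent R y\<bar> / norm (x - y) powr s)
           / ennreal (norm (x - y) ^ CARD('n))
       \<le> A a * (ennreal (tent_kernel CARD('n) s R (norm (x - y)))
              * (indicator (ball 0 R) x + indicator (ball 0 R) y))"
    (is "?L \<le> _")
proof -
  have A0: "A 0 = 0" using A by (simp add: young_function_def)
  show ?thesis
  proof (cases "x = y \<or> (x \<notin> ball 0 R \<and> y \<notin> ball 0 R)")
    case True
    then have "?L = 0" using tent_eq_0[OF R, of x] tent_eq_0[OF R, of y] A0 by auto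
    then show ?thesis by simp
  next
    case False
    let ?d = "norm (x - y)"
    let ?m = "min (?d / R) 1 / (?d / R) powr s"
    have d: "0 < ?d" using False by simp
    have m: "0 \<le> ?m" "?m \<le> 1"
    proof -
      show "0 \<le> ?m" using R by simp
      have "min (?d / R) 1 \<le> (?d / R) powr s"
      proof (cases "?d / R \<le> 1")
        case True
        then have "(?d / R) powr 1 \<le> (?d / R) powr s"
          using d R s by (intro powr_mono') auto
        then show ?thesis using True d R by simp
      next
        case False
        then have "1 \<le> (?d / R) powr s" using s by (intro ge_one_powr_ge_zero) auto
        then show ?thesis by simp
      qed
      then show "?m \<le> 1" using d R by (simp add: divide_le_eq)
    qed
    have "\<bar>a * R powr s * tent R x - a * R powr s * tent R y\<bar> / ?d powr s
        = a * R powr s * \<bar>tent R x - tent R y\<bar> / ?d powr s"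
      using a by (simp add: right_diff_distrib[symmetric] abs_mult)
    also have "\<dots> \<le> a * R powr s * min (?d / R) 1 / ?d powr s"
      using a by (intro divide_right_mono mult_left_mono tent_diff_le R) auto
    also have "\<dots> = ?m * a"
      using R d by (simp add: powr_divide)
    finally have "A (\<bar>a * R powr s * tent R x - a * R powr s * tent R y\<bar> / ?d powr s) \<le> A (?m * a)"
      by (intro young_function_mono[OF A]) auto
    also have "\<dots> \<le> ennreal ?m * A a"
      using m a by (intro young_function_scale[OF A]) auto
    finally have "?L \<le> ennreal ?m * A a / ennreal (?d ^ CARD('n))"
      by (rule divide_right_mono_ennreal)
    also have "\<dots> = A a * (ennreal ?m / ennreal (?d ^ CARD('n)))"
      by (simp add: ennreal_times_divide mult.commute)
    also have "ennreal ?m / ennreal (?d ^ CARD('n)) = ennreal (tent_kernel CARD('n) s R ?d)"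
      unfolding tent_kernel_def using m d by (intro divide_ennreal) auto
    also have "\<dots> \<le> \<dots> * (indicator (ball 0 R) x + indicator (ball 0 R) y)"
      using False by (auto simp: indicator_def mult_2_right distrib_left)
    finally show ?thesis by (simp add: mult_left_mono)
  qed
qed

text \<open>The kernel has integral at most \<open>\<kappa>\<close> in one variable, and an
  indicator confines the other variable to the ball. When the confined variable is the inner one,
  Fubini and the symmetry of the kernel exchange the two.\<close>

lemma tent_modular_le:
  assumes A: "young_function A" and s: "0 < s" "s < 1" and R: "0 < R" and a: "0 \<le> a" and \<kappa>: "0 \<le> \<kappa>"
    and K: "\<And>y::real^'n. (\<integral>\<^sup>+ x. ennreal (tent_kernel CARD('n) s R (norm (x - y))) \<partial>lebesgue) \<le> ennreal \<kappa>"
  shows "frac_modular s A (\<lambda>x::real^'n. a * R powr s * tent R x)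
         \<le> A a * ennreal (2 * \<kappa> * measure lebesgue (ball (0::real^'n) R))"
proof -
  let ?k = "\<lambda>x y::real^'n. ennreal (tent_kernel CARD('n) s R (norm (x - y)))"
  let ?B = "ball (0::real^'n) R"
  define m where "m = measure lebesgue ?B"
  have em: "emeasure lebesgue ?B = ennreal m"
    unfolding m_def using R by (intro measure_ball_real_vec) auto
  have [measurable]: "?B \<in> sets borel" by simp
  \<comment> \<open>The kernel is Borel, so the computation moves to \<open>lborel\<close>, where
    \<open>lborel_pair.Fubini'\<close> applies.\<close>
  have K': "(\<integral>\<^sup>+ x. ?k x y \<partial>lborel) \<le> ennreal \<kappa>" for y
    using K[of y] by (simp add: nn_integral_completion)
  have [measurable]: "(\<lambda>x. ?k x y) \<in> borel_measurable lborel" for y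
    unfolding tent_kernel_def by measurable
  have k2: "(\<lambda>(x, y). ?k x y * indicator ?B x) \<in> borel_measurable (lborel \<Otimes>\<^sub>M lborel)"
    unfolding tent_kernel_def by measurable
  have sym: "?k x y = ?k y x" for x y by (simp add: norm_minus_commute)
  have ball: "(\<integral>\<^sup>+ y. ennreal \<kappa> * indicator ?B y \<partial>lborel) = ennreal (\<kappa> * m)"
    using em \<kappa> by (simp add: nn_integral_cmult_indicator ennreal_mult m_def)
  have I2: "(\<integral>\<^sup>+ y. (\<integral>\<^sup>+ x. ?k x y * indicator ?B y \<partial>lborel) \<partial>lborel) \<le> ennreal (\<kappa> * m)"
  proof -
    have "(\<integral>\<^sup>+ y. (\<integral>\<^sup>+ x. ?k x y * indicator ?B y \<partial>lborel) \<partial>lborel)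
        \<le> (\<integral>\<^sup>+ y. ennreal \<kappa> * indicator ?B y \<partial>lborel)"
      using K' by (intro nn_integral_mono) (auto simp: indicator_def)
    then show ?thesis using ball by simp
  qed
  have I1: "(\<integral>\<^sup>+ y. (\<integral>\<^sup>+ x. ?k x y * indicator ?B x \<partial>lborel) \<partial>lborel) \<le> ennreal (\<kappa> * m)"
  proof -
    have "(\<integral>\<^sup>+ y. (\<integral>\<^sup>+ x. ?k x y * indicator ?B x \<partial>lborel) \<partial>lborel)
        = (\<integral>\<^sup>+ x. (\<integral>\<^sup>+ y. ?k x y * indicator ?B x \<partial>lborel) \<partial>lborel)"
      using k2 by (rule lborel_pair.Fubini')
    also have "\<dots> = (\<integral>\<^sup>+ x. (\<integral>\<^sup>+ y. ?k y x * indicator ?B x \<partial>lborel) \<partial>lborel)"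
      by (simp only: sym)
    finally show ?thesis using I2 by simp
  qed
  have [measurable]: "(\<lambda>y. \<integral>\<^sup>+ x. ?k x y * indicator ?B x \<partial>lborel) \<in> borel_measurable lborel"
    unfolding tent_kernel_def by measurable
  have [measurable]: "(\<lambda>y. \<integral>\<^sup>+ x. ?k x y * indicator ?B y \<partial>lborel) \<in> borel_measurable lborel"
    unfolding tent_kernel_def by measurable
  have "frac_modular s A (\<lambda>x::real^'n. a * R powr s * tent R x)
      \<le> (\<integral>\<^sup>+ y. (\<integral>\<^sup>+ x. A a * (?k x y * (indicator ?B x + indicator ?B y)) \<partial>lborel) \<partial>lborel)"
    unfolding frac_modular_def nn_integral_completion
    by (intro nn_integral_mono tent_modular_integrand_le A s R a)
  also have "\<dots> = (\<integral>\<^sup>+ y. A a * ((\<integral>\<^sup>+ x. ?k x y * indicator ?B x \<partial>lborel)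
      + (\<integral>\<^sup>+ x. ?k x y * indicator ?B y \<partial>lborel)) \<partial>lborel)"
    by (intro nn_integral_cong) (simp add: nn_integral_cmult nn_integral_add distrib_left)
  also have "\<dots> = A a * ((\<integral>\<^sup>+ y. \<integral>\<^sup>+ x. ?k x y * indicator ?B x \<partial>lborel \<partial>lborel)
      + (\<integral>\<^sup>+ y. \<integral>\<^sup>+ x. ?k x y * indicator ?B y \<partial>lborel \<partial>lborel))"
    by (simp add: nn_integral_cmult nn_integral_add)
  also have "\<dots> \<le> A a * (ennreal (\<kappa> * m) + ennreal (\<kappa> * m))"
    by (intro mult_left_mono add_mono I1 I2) auto
  also have "ennreal (\<kappa> * m) + ennreal (\<kappa> * m) = ennreal (2 * \<kappa> * m)"
    using \<kappa> by (simp add: ennreal_plus[symmetric] m_def del: ennreal_plus)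
  finally show ?thesis by (simp add: m_def)
qed

text \<open>The tent is at least \<open>3 / 4\<close> on the ball of radius \<open>R / 4\<close> about \<open>0\<close> and at most \<open>1 / 2\<close> on an
  equally large one near the boundary, so no constant is close to it on both.\<close>

lemma tent_deviation_lower_bound:
  fixes c :: real
  assumes R: "0 < R" and L: "0 \<le> L"
  shows "ennreal (L / 8 * (measure lebesgue (ball (0::real^'n) R) / 4 ^ CARD('n)))
         \<le> (\<integral>\<^sup>+ x\<in>ball (0::real^'n) R. ennreal \<bar>L * tent R x - c\<bar> \<partial>lebesgue)"
proof -
  let ?n = "CARD('n)"
  have key: "ennreal (L / 8 * (measure lebesgue (ball (0::real^'n) R) / 4 ^ ?n))
         \<le> (\<integral>\<^sup>+ x\<in>ball (0::real^'n) R. ennreal \<bar>L * tent R x - c\<bar> \<partial>lebesgue)"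
    if *: "\<And>x. x \<in> ball z (R / 4) \<Longrightarrow> x \<in> ball 0 R \<and> L / 8 \<le> \<bar>L * tent R x - c\<bar>" for z :: "real^'n"
  proof -
    have "measure lebesgue (ball z (R / 4)) = measure lebesgue (ball (0::real^'n) R) / 4 ^ ?n"
      using R by (simp add: content_ball power_divide)
    then have "ennreal (L / 8 * (measure lebesgue (ball (0::real^'n) R) / 4 ^ ?n))
        = (\<integral>\<^sup>+ x. ennreal (L / 8) * indicator (ball z (R / 4)) x \<partial>lebesgue)"
      using R L measure_ball_real_vec(2)[of "R / 4" z]
      by (subst nn_integral_cmult_indicator) (auto simp: ennreal_mult[symmetric])
    also have "\<dots> \<le> (\<integral>\<^sup>+ x\<in>ball (0::real^'n) R. ennreal \<bar>L * tent R x - c\<bar> \<partial>lebesgue)"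
      using * by (intro nn_integral_mono) (auto split: split_indicator intro!: ennreal_leI)
    finally show ?thesis .
  qed
  show ?thesis
  \<comment> \<open>\<open>5 / 8\<close> is the midpoint of \<open>1 / 2\<close> and
    \<open>3 / 4\<close>, so on one of the two small balls the distance from \<open>c\<close> is at
    least \<open>L / 8\<close>.\<close>
  proof (cases "c \<le> 5 / 8 * L")
    case True
    show ?thesis
    proof (rule key[of 0])
      fix x :: "real^'n" assume "x \<in> ball 0 (R / 4)"
      then have x: "norm x < R / 4" by simp
      then have "3 / 4 \<le> tent R x" using R by (simp add: tent_def max_def field_simps)
      then have "L * (3 / 4) \<le> L * tent R x" using L by (intro mult_left_mono) auto
      then show "x \<in> ball 0 R \<and> L / 8 \<le> \<bar>L * tent R x - c\<bar>" using x True R by (auto simp: abs_if)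
    qed
  next
    case False
    \<comment> \<open>The ball of radius \<open>R / 4\<close> about such a point lies between the
      spheres of radius \<open>R / 2\<close> and \<open>R\<close>.\<close>
    obtain z :: "real^'n" where z: "norm z = 3 / 4 * R"
      using vector_choose_size[of "3 / 4 * R"] R by auto
    show ?thesis
    proof (rule key[of z])
      fix x :: "real^'n" assume "x \<in> ball z (R / 4)"
      then have "norm (z - x) < R / 4" by (simp add: dist_norm)
      moreover have "norm z - norm x \<le> norm (z - x)" "norm x - norm z \<le> norm (z - x)"
        using norm_triangle_ineq2[of z x] norm_triangle_ineq2[of x z] by (auto simp: norm_minus_commute)
      ultimately have x: "R / 2 < norm x" "norm x < R" using z by auto
      then have "tent R x \<le> 1 / 2" using R by (simp add: tent_def max_def field_simps)
      then have "L * tent R x \<le> L * (1 / 2)" using L by (intro mult_left_mono) auto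
      then show "x \<in> ball 0 R \<and> L / 8 \<le> \<bar>L * tent R x - c\<bar>" using x False by (auto simp: abs_if)
    qed
  qed
qed

section \<open>Two-sided estimates of the mean oscillation by \<open>phi_sA\<close>\<close>

text \<open>This is \<open>campanato_osc\<close> without its weight, so that one upper and one lower
  estimate serve every \<open>\<phi>\<close>.\<close>

definition mean_oscillation :: "(real^'n \<Rightarrow> real) \<Rightarrow> (real^'n) set \<Rightarrow> ennreal" where
  "mean_oscillation u B =
     ennreal (1 / measure lebesgue B) * (\<integral>\<^sup>+ x\<in>B. ennreal \<bar>u x - average u B\<bar> \<partial>lebesgue)"

lemma ennreal_mult_mult:
  assumes "0 \<le> p" "0 \<le> q" "0 \<le> w"
  shows "ennreal (p * (q * w)) = ennreal p * (ennreal q * ennreal w)"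
  using assms by (simp add: ennreal_mult)

lemma campanato_osc_eq:
  fixes u :: "real^'n \<Rightarrow> real"
  shows "campanato_osc \<phi> u B
    = ennreal (1 / \<phi> (measure lebesgue B powr (1 / real CARD('n)))) * mean_oscillation u B"
  by (simp add: campanato_osc_def mean_oscillation_def mult.assoc)

lemma ballsE:
  fixes B :: "(real^'n) set"
  assumes "B \<in> balls"
  obtains z R where "B = ball z R" "0 < R"
    "measure lebesgue B powr (1 / real CARD('n)) = unit_ball_vol (real CARD('n)) powr (1 / real CARD('n)) * R"
    "measure lebesgue B = unit_ball_vol (real CARD('n)) * R ^ CARD('n)"
proof -
  obtain z R where B: "B = ball z R" and R: "0 < R" using assms unfolding balls_def by auto
  have m: "measure lebesgue B = unit_ball_vol (real CARD('n)) * R ^ CARD('n)"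
    unfolding B using R by (intro measure_ball_real_vec) auto
  have "(R ^ CARD('n)) powr (1 / real CARD('n)) = R"
    using R by (simp add: powr_realpow[symmetric] powr_powr)
  then have "measure lebesgue B powr (1 / real CARD('n)) = unit_ball_vol (real CARD('n)) powr (1 / real CARD('n)) * R"
    unfolding m using R by (simp add: powr_mult)
  then show thesis using B R m by (intro that) auto
qed

lemma frac_seminorm_finiteE:
  assumes "frac_seminorm s A u < \<infinity>"
  obtains l where "0 < l" "frac_modular s A (\<lambda>x. u x / l) \<le> 1"
  using assms unfolding frac_seminorm_def Inf_less_iff by blast

lemma mean_oscillation_le_phi_sA:
  assumes s: "0 < s"
  shows "\<exists>c>0. \<forall>A (u :: real^'n \<Rightarrow> real) B. young_function A \<longrightarrow> u \<in> borel_measurable lebesgue \<longrightarrow> B \<in> balls \<longrightarrow>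
    mean_oscillation u B
      \<le> ennreal (c * phi_sA CARD('n) s A (measure lebesgue B powr (1 / real CARD('n)))) * frac_seminorm s A u"
proof -
  let ?n = "CARD('n)"
  define \<omega> where "\<omega> = unit_ball_vol (real ?n)"
  have \<omega>: "0 < \<omega>" by (simp add: \<omega>_def)
  \<comment> \<open>The 4 combines the factor 2 for passing to the mean with the doubled inverse in
    \<open>E\<close>. The bracket is the deviation bound divided by \<open>E * m\<close>, and the
    last factor turns \<open>(2 * R) powr s\<close> into the power of the normalized radius.\<close>
  define c where "c = 4 * (1 + 2 * 2 ^ ?n / \<omega>) * (2 / \<omega> powr (1 / real ?n)) powr s"
  have c: "0 < c" using \<omega> by (auto simp: c_def intro!: mult_pos_pos add_pos_pos)
  have "mean_oscillation u B
      \<le> ennreal (c * phi_sA ?n s A (measure lebesgue B powr (1 / real ?n))) * frac_seminorm s A u"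
    if A: "young_function A" and u: "u \<in> borel_measurable lebesgue" and "B \<in> balls"
    for A and u :: "real^'n \<Rightarrow> real" and B
  proof -
    define m where "m = measure lebesgue B"
    obtain z R where B: "B = ball z R" and R: "0 < R"
      and r: "m powr (1 / real ?n) = \<omega> powr (1 / real ?n) * R" and m: "m = \<omega> * R ^ ?n"
      using \<open>B \<in> balls\<close> unfolding m_def \<omega>_def by (rule ballsE)
    have mpos: "0 < m" using \<omega> R m by simp
    define i where "i = young_inverse A (1 / m)"
    define K where "K = c * phi_sA ?n s A (m powr (1 / real ?n))"
    have ipos: "0 < i" using A mpos by (simp add: i_def young_inverse_pos)
    have K: "0 < K" using c A mpos by (simp add: K_def phi_sA_pos)
    have "(m powr (1 / real ?n)) powr (- real ?n) = 1 / m"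
      using mpos by (simp add: powr_powr powr_minus_divide)
    then have K_eq: "K = 4 * (1 + 2 * 2 ^ ?n / \<omega>) * (2 * R) powr s * i"
      using \<omega> R by (simp add: K_def c_def phi_sA_def i_def r powr_mult powr_divide)
    have step: "mean_oscillation u B \<le> ennreal K * ennreal l"
      if l: "0 < l" "frac_modular s A (\<lambda>x. u x / l) \<le> 1" for l
    proof -
      define E where "E = l * (2 * R) powr s * (2 * i)"
      have Epos: "0 < E" using l R ipos by (simp add: E_def)
      obtain d where d: "(\<integral>\<^sup>+ x\<in>B. ennreal \<bar>u x - d\<bar> \<partial>lebesgue) \<le> ennreal (E * m + 2 * E * (2 * R) ^ ?n)"
        using modular_mean_deviation_bound[OF A s u l R, of z] unfolding B[symmetric] m_def[symmetric] i_def[symmetric] E_def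
        by blast
      have "(\<integral>\<^sup>+ x\<in>B. ennreal \<bar>u x - average u B\<bar> \<partial>lebesgue) \<le> 2 * (\<integral>\<^sup>+ x\<in>B. ennreal \<bar>u x - d\<bar> \<partial>lebesgue)"
        unfolding B using u R by (rule deviation_from_average_le)
      also have "\<dots> \<le> 2 * ennreal (E * m + 2 * E * (2 * R) ^ ?n)"
        using d by (intro mult_left_mono) auto
      finally have "mean_oscillation u B \<le> ennreal (1 / m) * (ennreal 2 * ennreal (E * m + 2 * E * (2 * R) ^ ?n))"
        unfolding mean_oscillation_def m_def by (intro mult_left_mono) auto
      also have "\<dots> = ennreal (1 / m * (2 * (E * m + 2 * E * (2 * R) ^ ?n)))"
      proof -
        have "0 \<le> E * m + 2 * E * (2 * R) ^ ?n" using Epos mpos R by simp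
        then show ?thesis using mpos by (intro ennreal_mult_mult[symmetric]) auto
      qed
      also have "1 / m * (2 * (E * m + 2 * E * (2 * R) ^ ?n)) = K * l"
        unfolding K_eq E_def m using \<omega> R by (simp add: field_simps)
      finally show ?thesis using K l by (simp add: ennreal_mult)
    qed
    \<comment> \<open>After division by \<open>K\<close>, the estimates for single \<open>l\<close>
      say that the left side is a lower bound of the set whose infimum is the seminorm.\<close>
    have "ennreal (1 / K) * mean_oscillation u B \<le> frac_seminorm s A u"
      unfolding frac_seminorm_def
    proof (rule Inf_greatest)
      fix x assume "x \<in> {ennreal l |l. 0 < l \<and> frac_modular s A (\<lambda>x. u x / l) \<le> 1}"
      then obtain l where l: "x = ennreal l" "0 < l" "frac_modular s A (\<lambda>x. u x / l) \<le> 1" by blast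
      have "ennreal (1 / K) * mean_oscillation u B \<le> ennreal (1 / K) * (ennreal K * ennreal l)"
        using step[OF l(2,3)] by (rule mult_left_mono) simp
      also have "\<dots> = x" using K l by (simp add: mult.assoc[symmetric] ennreal_mult[symmetric])
      finally show "ennreal (1 / K) * mean_oscillation u B \<le> x" .
    qed
    then have "ennreal K * (ennreal (1 / K) * mean_oscillation u B) \<le> ennreal K * frac_seminorm s A u"
      by (rule mult_left_mono) simp
    moreover have "ennreal K * ennreal (1 / K) = 1"
      using K by (simp add: ennreal_mult[symmetric])
    ultimately have "mean_oscillation u B \<le> ennreal K * frac_seminorm s A u"
      by (simp only: mult.assoc[symmetric] mult_1_left)
    then show ?thesis unfolding K_def m_def .
  qed
  with c show ?thesis by blast
qed

text \<open>A compact set lies in a ball, on which \<open>u\<close> has finite deviation from some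
  constant and is therefore integrable.\<close>

lemma frac_orlicz_sobolev_subset_L1_loc:
  assumes A: "young_function A" and s: "0 < s"
  shows "(frac_orlicz_sobolev s A :: (real^'n \<Rightarrow> real) set) \<subseteq> L1_loc"
proof
  fix u :: "real^'n \<Rightarrow> real" assume "u \<in> frac_orlicz_sobolev s A"
  then have u: "u \<in> borel_measurable lebesgue" and fin: "frac_seminorm s A u < \<infinity>"
    by (auto simp: frac_orlicz_sobolev_def)
  obtain l where l: "0 < l" "frac_modular s A (\<lambda>x. u x / l) \<le> 1"
    using fin by (rule frac_seminorm_finiteE)
  have "set_integrable lebesgue K u" if K: "compact K" for K
  proof -
    obtain R where R: "0 < R" "K \<subseteq> ball 0 R"
      using bounded_subset_ballD[OF compact_imp_bounded[OF K], of 0] by blast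
    obtain c M where "(\<integral>\<^sup>+ x\<in>ball 0 R. ennreal \<bar>u x - c\<bar> \<partial>lebesgue) \<le> ennreal M"
      using modular_mean_deviation_bound[OF A s u l R(1), of 0] by blast
    then have "(\<integral>\<^sup>+ x\<in>ball 0 R. ennreal \<bar>u x - c\<bar> \<partial>lebesgue) < \<infinity>"
      by (rule le_less_trans) simp
    with u have "set_integrable lebesgue (ball 0 R) u" by (rule set_integrable_of_deviation)
    then show ?thesis
      using fmeasurableD[OF lmeasurable_compact[OF K]] R(2) by (rule set_integrable_subset)
  qed
  then show "u \<in> L1_loc" by (simp add: L1_loc_def)
qed

text \<open>The witness is a tent supported by a ball of volume \<open>r ^ CARD('n)\<close>, with
  height proportional to \<open>phi_sA\<close>. The constant is again fixed before \<open>A\<close>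
  and \<open>r\<close>.\<close>

lemma phi_sA_sharp:
  assumes s: "0 < s" "s < 1"
  shows "\<exists>c>0. \<forall>A r. young_function A \<longrightarrow> 0 < r \<longrightarrow>
    (\<exists>u \<in> (frac_orlicz_sobolev s A :: (real^'n \<Rightarrow> real) set). \<exists>B\<in>balls.
       frac_seminorm s A u \<le> 1 \<and> measure lebesgue B = r ^ CARD('n) \<and>
       ennreal (c * phi_sA CARD('n) s A r) \<le> mean_oscillation u B)"
proof -
  let ?n = "CARD('n)"
  define \<omega> where "\<omega> = unit_ball_vol (real ?n)"
  have \<omega>: "0 < \<omega>" by (simp add: \<omega>_def)
  define \<rho> where "\<rho> = \<omega> powr (1 / real ?n)"
  have \<rho>: "0 < \<rho>" "\<rho> ^ ?n = \<omega>"
    using \<omega> by (auto simp: \<rho>_def powr_realpow[symmetric] powr_powr)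
  obtain \<kappa> where \<kappa>: "0 < \<kappa>" and K: "\<And>R y. 0 < R \<Longrightarrow>
      (\<integral>\<^sup>+ x. ennreal (tent_kernel ?n s R (norm (x - (y::real^'n)))) \<partial>lebesgue) \<le> ennreal \<kappa>"
    using tent_kernel_integral_bound[OF s] by blast
  define C where "C = max 1 (2 * \<kappa>)"
  have C: "1 \<le> C" "2 * \<kappa> \<le> C" by (auto simp: C_def)
  \<comment> \<open>The factor 16 is the 8 of the tent deviation times the 2 of the halved inverse.
    The power of 4 is the volume ratio of the small balls, and \<open>\<rho> powr s\<close> comes
    from \<open>R = r / \<rho>\<close>.\<close>
  define c where "c = 1 / (16 * C * 4 ^ ?n * \<rho> powr s)"
  have c: "0 < c" using C \<rho> by (simp add: c_def)
  have "\<exists>u \<in> (frac_orlicz_sobolev s A :: (real^'n \<Rightarrow> real) set). \<exists>B\<in>balls.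
       frac_seminorm s A u \<le> 1 \<and> measure lebesgue B = r ^ ?n \<and>
       ennreal (c * phi_sA ?n s A r) \<le> mean_oscillation u B"
    if A: "young_function A" and r: "0 < r" for A r
  proof -
    define R where "R = r / \<rho>"
    have R: "0 < R" using r \<rho> by (simp add: R_def)
    let ?B = "ball (0::real^'n) R"
    have m: "measure lebesgue ?B = r ^ ?n"
      using measure_ball_real_vec(1)[of R "0::real^'n"] R \<rho> \<omega>
      by (simp add: R_def \<omega>_def[symmetric] power_divide)
    define b where "b = young_inverse A (r powr (- real ?n))"
    have b: "0 < b" using A r by (simp add: b_def young_inverse_pos)
    \<comment> \<open>Strictly below the inverse, \<open>A\<close> is at most the reciprocal of the
      volume of \<open>?B\<close>, which cancels the volume in the bound for the modular.\<close>
    have Ab: "A (b / 2) \<le> ennreal (r powr (- real ?n))"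
      using b by (intro young_function_le_below_inverse) (auto simp: b_def)
    \<comment> \<open>The factor \<open>1 / C\<close> absorbs \<open>2 * \<kappa>\<close> and makes
      the modular at most 1; \<open>C \<ge> 1\<close> permits the scaling inequality.\<close>
    define a where "a = 1 / C * (b / 2)"
    have a: "0 \<le> a" using b C by (simp add: a_def)
    define u :: "real^'n \<Rightarrow> real" where "u = (\<lambda>x. a * R powr s * tent R x)"
    have "frac_modular s A u \<le> A a * ennreal (2 * \<kappa> * r ^ ?n)"
      unfolding u_def m[symmetric] using \<kappa> a by (intro tent_modular_le A s R K) auto
    also have "A a \<le> ennreal (1 / C) * A (b / 2)"
      unfolding a_def using C b by (intro young_function_scale A) auto
    also note Ab
    also have "ennreal (1 / C) * ennreal (r powr (- real ?n)) * ennreal (2 * \<kappa> * r ^ ?n)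
        = ennreal (1 / C * (r powr (- real ?n) * (2 * \<kappa> * r ^ ?n)))"
      unfolding mult.assoc using C \<kappa> r ennreal_mult_mult[of "1 / C" "r powr (- real ?n)" "2 * \<kappa> * r ^ ?n"]
      by (simp add: mult.assoc)
    also have "1 / C * (r powr (- real ?n) * (2 * \<kappa> * r ^ ?n)) = 2 * \<kappa> / C"
      using r by (simp add: powr_minus_divide powr_realpow)
    also have "ennreal (2 * \<kappa> / C) \<le> ennreal 1"
      using C by (intro ennreal_leI) simp
    finally have J: "frac_modular s A u \<le> 1"
      by (auto simp: mult_left_mono mult_right_mono)
    have "frac_seminorm s A u \<le> ennreal 1"
      unfolding frac_seminorm_def using J by (intro Inf_lower) (auto intro!: exI[of _ 1])
    then have norm: "frac_seminorm s A u \<le> 1" by simp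
    have "u \<in> borel_measurable lebesgue"
      unfolding u_def tent_def by (intro measurable_completion) measurable
    moreover have "frac_seminorm s A u < \<infinity>"
      using norm by (rule le_less_trans) simp
    ultimately have u: "u \<in> frac_orlicz_sobolev s A"
      by (simp add: frac_orlicz_sobolev_def)
    define L where "L = a * R powr s"
    have L: "0 \<le> L" using a by (simp add: L_def)
    have "c * phi_sA ?n s A r = 1 / r ^ ?n * (L / 8 * (r ^ ?n / 4 ^ ?n))"
      using r \<rho> C by (simp add: c_def phi_sA_def b_def[symmetric] L_def a_def R_def powr_divide mult_ac)
    also have "ennreal (1 / r ^ ?n * (L / 8 * (r ^ ?n / 4 ^ ?n)))
        = ennreal (1 / r ^ ?n) * ennreal (L / 8 * (r ^ ?n / 4 ^ ?n))"
      using r L by (intro ennreal_mult) auto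
    also have "\<dots> \<le> mean_oscillation u ?B"
      unfolding mean_oscillation_def m
      using tent_deviation_lower_bound[where 'n = 'n, OF R L, of "average u ?B"]
      unfolding m L_def[symmetric] u_def by (intro mult_left_mono) simp_all
    finally have "ennreal (c * phi_sA ?n s A r) \<le> mean_oscillation u ?B" .
    moreover have "?B \<in> balls" using R by (auto simp: balls_def)
    ultimately show ?thesis
      using u norm m by (intro bexI[of _ u] bexI[of _ ?B] conjI)
  qed
  with c show ?thesis by (intro exI[of _ c] conjI allI impI)
qed

section \<open>Embeddings as comparisons of weights\<close>

text \<open>The weights are compared only at the normalized radius of the given ball. Hence
  \<open>q\<close> can be a global constant for the embedding and a small number on small balls for
  the vanishing condition.\<close>

lemma campanato_osc_le_frac_seminorm:
  assumes s: "0 < s"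
  shows "\<exists>c>0. \<forall>A \<phi> (u :: real^'n \<Rightarrow> real) B q.
    young_function A \<longrightarrow> u \<in> borel_measurable lebesgue \<longrightarrow> B \<in> balls \<longrightarrow> 0 \<le> q \<longrightarrow>
    0 < \<phi> (measure lebesgue B powr (1 / real CARD('n))) \<longrightarrow>
    phi_sA CARD('n) s A (measure lebesgue B powr (1 / real CARD('n)))
      \<le> q * \<phi> (measure lebesgue B powr (1 / real CARD('n))) \<longrightarrow>
    campanato_osc \<phi> u B \<le> ennreal (c * q) * frac_seminorm s A u"
proof -
  obtain c where c: "0 < c" and le: "\<And>A (u :: real^'n \<Rightarrow> real) B. young_function A \<Longrightarrow> u \<in> borel_measurable lebesgue \<Longrightarrow> B \<in> balls \<Longrightarrow>
    mean_oscillation u B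
      \<le> ennreal (c * phi_sA CARD('n) s A (measure lebesgue B powr (1 / real CARD('n)))) * frac_seminorm s A u"
    using mean_oscillation_le_phi_sA[OF s] by blast
  have "campanato_osc \<phi> u B \<le> ennreal (c * q) * frac_seminorm s A u"
    if A: "young_function A" and u: "u \<in> borel_measurable lebesgue" and B: "B \<in> balls" and "0 \<le> q"
      and r: "r = measure lebesgue B powr (1 / real CARD('n))"
      and \<phi>: "0 < \<phi> r" "phi_sA CARD('n) s A r \<le> q * \<phi> r"
    for A \<phi> and u :: "real^'n \<Rightarrow> real" and B q r
  proof -
    have "campanato_osc \<phi> u B \<le> ennreal (1 / \<phi> r) * (ennreal (c * phi_sA CARD('n) s A r) * frac_seminorm s A u)"
      unfolding campanato_osc_eq r by (intro mult_left_mono le A u B) simp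
    also have "\<dots> = ennreal (1 / \<phi> r * (c * phi_sA CARD('n) s A r)) * frac_seminorm s A u"
      using \<phi> by (subst ennreal_mult') (auto simp: mult.assoc)
    also have "\<dots> \<le> ennreal (c * q) * frac_seminorm s A u"
    proof (intro mult_right_mono ennreal_leI)
      have "1 / \<phi> r * (c * phi_sA CARD('n) s A r) \<le> 1 / \<phi> r * (c * (q * \<phi> r))"
        using \<phi> c by (intro mult_left_mono) auto
      then show "1 / \<phi> r * (c * phi_sA CARD('n) s A r) \<le> c * q" using \<phi> by simp
    qed simp
    finally show ?thesis .
  qed
  with c show ?thesis by blast
qed

lemma balls_measure_pos:
  fixes B :: "(real^'n) set"
  assumes "B \<in> balls"
  shows "0 < measure lebesgue B" "0 < measure lebesgue B powr (1 / real CARD('n))"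
proof -
  show "0 < measure lebesgue B"
    using assms by (rule ballsE) simp
  then show "0 < measure lebesgue B powr (1 / real CARD('n))" by simp
qed

lemma sobolev_into_campanatoI:
  assumes A: "young_function A" and s: "0 < s"
    and q: "0 < q"
    and le: "\<And>(u :: real^'n \<Rightarrow> real) B. u \<in> frac_orlicz_sobolev s A \<Longrightarrow> B \<in> balls \<Longrightarrow>
      campanato_osc \<phi> u B \<le> ennreal q * frac_seminorm s A u"
  shows "sobolev_into_campanato TYPE('n::finite) s A \<phi>"
    and "u \<in> (frac_orlicz_sobolev s A :: (real^'n \<Rightarrow> real) set) \<Longrightarrow>
      campanato_seminorm \<phi> u \<le> ennreal q * frac_seminorm s A u"
proof -
  show *: "campanato_seminorm \<phi> u \<le> ennreal q * frac_seminorm s A u"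
    if "u \<in> frac_orlicz_sobolev s A" for u :: "real^'n \<Rightarrow> real"
    unfolding campanato_seminorm_def using le that by (intro SUP_least) auto
  have "frac_orlicz_sobolev s A \<subseteq> (campanato \<phi> :: (real^'n \<Rightarrow> real) set)"
  proof
    fix u :: "real^'n \<Rightarrow> real" assume u: "u \<in> frac_orlicz_sobolev s A"
    then have "ennreal q * frac_seminorm s A u < \<infinity>"
      by (simp add: frac_orlicz_sobolev_def ennreal_mult_less_top)
    with *[OF u] have "campanato_seminorm \<phi> u < \<infinity>"
      by (rule le_less_trans)
    then show "u \<in> campanato \<phi>"
      using frac_orlicz_sobolev_subset_L1_loc[OF A s] u by (auto simp: campanato_def)
  qed
  then show "sobolev_into_campanato TYPE('n) s A \<phi>"
    unfolding sobolev_into_campanato_def continuously_embedded_def using * q by blast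
qed

lemma campanato_osc_sharp:
  assumes s: "0 < s" "s < 1"
  shows "\<exists>c>0. \<forall>A \<phi> r. young_function A \<longrightarrow> 0 < r \<longrightarrow> 0 < \<phi> r \<longrightarrow>
    (\<exists>u \<in> (frac_orlicz_sobolev s A :: (real^'n \<Rightarrow> real) set). \<exists>B\<in>balls.
       frac_seminorm s A u \<le> 1 \<and> measure lebesgue B = r ^ CARD('n) \<and>
       ennreal (c * (phi_sA CARD('n) s A r / \<phi> r)) \<le> campanato_osc \<phi> u B)"
proof -
  let ?n = "CARD('n)"
  obtain c where c: "0 < c" and sharp: "\<And>A r. young_function A \<Longrightarrow> 0 < r \<Longrightarrow>
    \<exists>u \<in> (frac_orlicz_sobolev s A :: (real^'n \<Rightarrow> real) set). \<exists>B\<in>balls.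
       frac_seminorm s A u \<le> 1 \<and> measure lebesgue B = r ^ ?n \<and>
       ennreal (c * phi_sA ?n s A r) \<le> mean_oscillation u B"
    using phi_sA_sharp[OF s] by blast
  have "\<exists>u \<in> (frac_orlicz_sobolev s A :: (real^'n \<Rightarrow> real) set). \<exists>B\<in>balls.
       frac_seminorm s A u \<le> 1 \<and> measure lebesgue B = r ^ ?n \<and>
       ennreal (c * (phi_sA ?n s A r / \<phi> r)) \<le> campanato_osc \<phi> u B"
    if A: "young_function A" and r: "0 < r" and \<phi>: "0 < \<phi> r" for A \<phi> r
  proof -
    obtain u :: "real^'n \<Rightarrow> real" and B where u: "u \<in> frac_orlicz_sobolev s A" "frac_seminorm s A u \<le> 1"
      and B: "B \<in> balls" "measure lebesgue B = r ^ ?n"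
      and osc: "ennreal (c * phi_sA ?n s A r) \<le> mean_oscillation u B"
      using sharp[OF A r] by blast
    have root: "measure lebesgue B powr (1 / real ?n) = r"
      using r by (simp add: B powr_realpow[symmetric] powr_powr)
    have "ennreal (c * (phi_sA ?n s A r / \<phi> r)) = ennreal (1 / \<phi> r) * ennreal (c * phi_sA ?n s A r)"
      using \<phi> by (subst ennreal_mult'[symmetric]) auto
    also have "\<dots> \<le> campanato_osc \<phi> u B"
      unfolding campanato_osc_eq root using osc by (rule mult_left_mono) simp
    finally show ?thesis using u B by blast
  qed
  with c show ?thesis by blast
qed

text \<open>For each \<open>r\<close> the embedding is tested on the tent that is sharp at
  \<open>r\<close>; its lower bound has a factor \<open>c\<close> independent of
  \<open>r\<close>.\<close>

lemma phi_sA_le_of_embedding: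
  assumes s: "0 < s" "s < 1" and A: "young_function A" and \<phi>: "\<And>r. 0 < r \<Longrightarrow> 0 < \<phi> r"
    and emb: "sobolev_into_campanato TYPE('n::finite) s A \<phi>"
  shows "\<exists>C>0. \<forall>r>0. phi_sA CARD('n) s A r \<le> C * \<phi> r"
proof -
  obtain c where c: "0 < c" and sharp: "\<And>r. 0 < r \<Longrightarrow>
    \<exists>u \<in> (frac_orlicz_sobolev s A :: (real^'n \<Rightarrow> real) set). \<exists>B\<in>balls.
       frac_seminorm s A u \<le> 1 \<and> measure lebesgue B = r ^ CARD('n) \<and>
       ennreal (c * (phi_sA CARD('n) s A r / \<phi> r)) \<le> campanato_osc \<phi> u B"
    using campanato_osc_sharp[OF s] A \<phi> by blast
  obtain C where C: "0 < C" and bound: "\<And>u :: real^'n \<Rightarrow> real. u \<in> frac_orlicz_sobolev s A \<Longrightarrow>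
      campanato_seminorm \<phi> u \<le> ennreal C * frac_seminorm s A u"
    using emb unfolding sobolev_into_campanato_def continuously_embedded_def by blast
  have "phi_sA CARD('n) s A r \<le> C / c * \<phi> r" if r: "0 < r" for r
  proof -
    obtain u :: "real^'n \<Rightarrow> real" and B where u: "u \<in> frac_orlicz_sobolev s A" "frac_seminorm s A u \<le> 1"
      and B: "B \<in> balls" and osc: "ennreal (c * (phi_sA CARD('n) s A r / \<phi> r)) \<le> campanato_osc \<phi> u B"
      using sharp[OF r] by blast
    note osc
    also have "campanato_osc \<phi> u B \<le> campanato_seminorm \<phi> u"
      unfolding campanato_seminorm_def using B by (rule SUP_upper)
    also have "\<dots> \<le> ennreal C * frac_seminorm s A u" by (rule bound[OF u(1)])
    also have "\<dots> \<le> ennreal C * 1" using u(2) by (intro mult_left_mono) auto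
    finally have "c * (phi_sA CARD('n) s A r / \<phi> r) \<le> C" using C by simp
    then show ?thesis using c \<phi>[OF r] by (simp add: field_simps)
  qed
  then show ?thesis using c C by (intro exI[of _ "C / c"]) auto
qed

lemma campanato_into_campanatoI:
  assumes \<psi>: "\<And>r. 0 < r \<Longrightarrow> 0 < \<psi> r" and \<phi>: "\<And>r. 0 < r \<Longrightarrow> 0 < \<phi> r"
    and C: "0 < C" and le: "\<And>r. 0 < r \<Longrightarrow> \<psi> r \<le> C * \<phi> r"
  shows "campanato_into_campanato TYPE('n::finite) \<psi> \<phi>"
proof -
  have osc: "campanato_osc \<phi> u B \<le> ennreal C * campanato_osc \<psi> u B" if B: "B \<in> balls" for u :: "real^'n \<Rightarrow> real" and B
  proof -
    let ?r = "measure lebesgue B powr (1 / real CARD('n))"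
    have r: "0 < ?r" using B by (rule balls_measure_pos)
    have "1 / \<phi> ?r \<le> C * (1 / \<psi> ?r)" using le[OF r] \<psi>[OF r] \<phi>[OF r] by (simp add: field_simps)
    then have "ennreal (1 / \<phi> ?r) \<le> ennreal C * ennreal (1 / \<psi> ?r)"
      using C \<psi>[OF r] by (simp add: ennreal_mult[symmetric] ennreal_leI)
    then show ?thesis unfolding campanato_osc_eq mult.assoc[symmetric] by (rule mult_right_mono) simp
  qed
  have norm: "campanato_seminorm \<phi> u \<le> ennreal C * campanato_seminorm \<psi> u" for u :: "real^'n \<Rightarrow> real"
    unfolding campanato_seminorm_def
  proof (rule SUP_least)
    fix B :: "(real^'n) set" assume B: "B \<in> balls"
    have "campanato_osc \<phi> u B \<le> ennreal C * campanato_osc \<psi> u B" using B by (rule osc)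
    also have "\<dots> \<le> ennreal C * (SUP B\<in>balls. campanato_osc \<psi> u B)"
      using B by (intro mult_left_mono SUP_upper) auto
    finally show "campanato_osc \<phi> u B \<le> ennreal C * (SUP B\<in>balls. campanato_osc \<psi> u B)" .
  qed
  have "campanato \<psi> \<subseteq> (campanato \<phi> :: (real^'n \<Rightarrow> real) set)"
  proof
    fix u :: "real^'n \<Rightarrow> real" assume u: "u \<in> campanato \<psi>"
    then have "ennreal C * campanato_seminorm \<psi> u < \<infinity>"
      by (simp add: campanato_def ennreal_mult_less_top)
    with norm[of u] have "campanato_seminorm \<phi> u < \<infinity>"
      by (rule le_less_trans)
    then show "u \<in> campanato \<phi>" using u by (simp add: campanato_def)
  qed
  then show ?thesis
    unfolding campanato_into_campanato_def continuously_embedded_def using norm C by blast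
qed

section \<open>Uniform vanishing and the limit of the quotient of the weights\<close>

text \<open>The quotient at the normalized radius of a ball bounds the oscillation there from above
  on the unit ball of the seminorm, and sharp tents bound it from below. The supremum restricts the
  volume of the ball while the quotient sees its \<open>CARD('n)\<close>-th root, so the two
  neighbourhoods of 0 are matched through powers.\<close>

lemma uniform_vanishing_iff:
  fixes s :: real and A :: "real \<Rightarrow> ennreal" and \<phi> :: "real \<Rightarrow> real"
  assumes s: "0 < s" "s < 1" and A: "young_function A" and \<phi>: "\<And>r. 0 < r \<Longrightarrow> 0 < \<phi> r"
    and emb: "sobolev_into_campanato TYPE('n::finite) s A \<phi>"
  shows "sobolev_into_vanishing_campanato_uniformly TYPE('n) s A \<phi>
    \<longleftrightarrow> ((\<lambda>r. phi_sA CARD('n) s A r / \<phi> r) \<longlongrightarrow> 0) (at_right 0)"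
proof -
  let ?n = "CARD('n)"
  let ?X = "{u \<in> frac_orlicz_sobolev s A :: (real^'n \<Rightarrow> real) set. frac_seminorm s A u \<le> 1}"
  define f where "f r = (SUP u\<in>?X. SUP B\<in>{B \<in> balls. measure lebesgue B \<le> r}. campanato_osc \<phi> u B)" for r
  define g where "g r = phi_sA ?n s A r / \<phi> r" for r
  have g_pos: "0 < g r" if "0 < r" for r
    using that \<phi> A by (simp add: g_def phi_sA_pos)
  have "(f \<longlongrightarrow> 0) (at_right 0) \<longleftrightarrow> (g \<longlongrightarrow> 0) (at_right 0)"
  proof
    assume f: "(f \<longlongrightarrow> 0) (at_right 0)"
    obtain c where c: "0 < c" and sharp: "\<And>r. 0 < r \<Longrightarrow>
      \<exists>u \<in> (frac_orlicz_sobolev s A :: (real^'n \<Rightarrow> real) set). \<exists>B\<in>balls.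
         frac_seminorm s A u \<le> 1 \<and> measure lebesgue B = r ^ ?n \<and>
         ennreal (c * g r) \<le> campanato_osc \<phi> u B"
      unfolding g_def using campanato_osc_sharp[OF s] A \<phi> by blast
    show "(g \<longlongrightarrow> 0) (at_right 0)"
    proof (rule order_tendstoI)
      fix e :: real assume "e < 0"
      show "\<forall>\<^sub>F r in at_right 0. e < g r"
        using \<open>e < 0\<close> g_pos by (intro eventually_at_rightI[of 0 1]) (auto intro: less_trans)
    next
      fix e :: real assume e: "0 < e"
      have "\<forall>\<^sub>F r in at_right 0. f r < ennreal (c * e)"
        using f e c by (intro order_tendstoD) auto
      then obtain b where b: "0 < b" "\<And>r. 0 < r \<Longrightarrow> r < b \<Longrightarrow> f r < ennreal (c * e)"
        unfolding eventually_at_right_field by blast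
      have "g r < e" if r: "0 < r" "r < min 1 b" for r
      proof -
        obtain u :: "real^'n \<Rightarrow> real" and B where u: "u \<in> ?X" and B: "B \<in> balls" "measure lebesgue B = r ^ ?n"
          and osc: "ennreal (c * g r) \<le> campanato_osc \<phi> u B"
          using sharp[OF r(1)] by blast
        \<comment> \<open>The sharp ball has volume \<open>r ^ ?n\<close>; for \<open>r < 1\<close>
          this stays below \<open>b\<close>, where \<open>f\<close> is already small.\<close>
        have "r ^ ?n \<le> r ^ 1" using r by (intro power_decreasing) auto
        then have "r ^ ?n < b" using r by simp
        note osc
        also have "campanato_osc \<phi> u B \<le> (SUP B\<in>{B \<in> balls. measure lebesgue B \<le> r ^ ?n}. campanato_osc \<phi> u B)"
          using B by (intro SUP_upper) auto
        also have "\<dots> \<le> f (r ^ ?n)" unfolding f_def using u by (rule SUP_upper)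
        also have "f (r ^ ?n) < ennreal (c * e)" using r \<open>r ^ ?n < b\<close> by (intro b) auto
        finally show "g r < e" using c g_pos[OF r(1)] by (simp add: ennreal_less_iff)
      qed
      then show "\<forall>\<^sub>F r in at_right 0. g r < e"
        using b by (intro eventually_at_rightI[of 0 "min 1 b"]) auto
    qed
  next
    assume g: "(g \<longlongrightarrow> 0) (at_right 0)"
    obtain c where c: "0 < c" and le: "\<And>(u :: real^'n \<Rightarrow> real) B q.
        u \<in> borel_measurable lebesgue \<Longrightarrow> B \<in> balls \<Longrightarrow> 0 \<le> q \<Longrightarrow>
        0 < \<phi> (measure lebesgue B powr (1 / real ?n)) \<Longrightarrow>
        phi_sA ?n s A (measure lebesgue B powr (1 / real ?n)) \<le> q * \<phi> (measure lebesgue B powr (1 / real ?n)) \<Longrightarrow>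
        campanato_osc \<phi> u B \<le> ennreal (c * q) * frac_seminorm s A u"
      using campanato_osc_le_frac_seminorm[OF s(1)] A by blast
    show "(f \<longlongrightarrow> 0) (at_right 0)"
    proof (rule order_tendstoI)
      fix a :: ennreal assume "0 < a"
      \<comment> \<open>As \<open>a\<close> may be infinite, a smaller positive and finite bound is
        converted to a real.\<close>
      then obtain a' where a': "0 < a'" "a' < a" using dense by blast
      define e where "e = enn2real a'"
      have "a' < top" using a'(2) by (rule less_le_trans) simp
      then have e: "0 < e" "ennreal e < a"
        using a' by (auto simp: e_def enn2real_positive_iff)
      have "\<forall>\<^sub>F r in at_right 0. g r < e / c"
        using g e c by (intro order_tendstoD) auto
      then obtain b where b: "0 < b" "\<And>r. 0 < r \<Longrightarrow> r < b \<Longrightarrow> g r < e / c"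
        unfolding eventually_at_right_field by blast
      \<comment> \<open>Balls of volume below \<open>b ^ ?n\<close> have normalized radius below
        \<open>b\<close>.\<close>
      have "f r < a" if r: "0 < r" "r < b ^ ?n" for r
      proof -
        have "f r \<le> ennreal e"
          unfolding f_def
        proof (intro SUP_least)
          fix u :: "real^'n \<Rightarrow> real" and B :: "(real^'n) set"
          assume u: "u \<in> ?X" and B: "B \<in> {B \<in> balls. measure lebesgue B \<le> r}"
          let ?r = "measure lebesgue B powr (1 / real ?n)"
          have pos: "0 < measure lebesgue B" "0 < ?r" using B balls_measure_pos[of B] by auto
          have "?r < (b ^ ?n) powr (1 / real ?n)"
            using B r by (intro powr_less_mono2) auto
          also have "\<dots> = b" using b by (simp add: powr_realpow[symmetric] powr_powr)
          finally have "g ?r < e / c" using pos by (intro b) auto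
          then have "phi_sA ?n s A ?r \<le> e / c * \<phi> ?r"
            using \<phi>[OF pos(2)] by (simp add: g_def field_simps)
          then have "campanato_osc \<phi> u B \<le> ennreal (c * (e / c)) * frac_seminorm s A u"
            using u B e c \<phi>[OF pos(2)] by (intro le) (auto simp: frac_orlicz_sobolev_def)
          also have "\<dots> \<le> ennreal (c * (e / c)) * 1"
            using u by (intro mult_left_mono) auto
          finally show "campanato_osc \<phi> u B \<le> ennreal e" using c by simp
        qed
        also note e(2)
        finally show ?thesis .
      qed
      then show "\<forall>\<^sub>F r in at_right 0. f r < a"
        using b by (intro eventually_at_rightI[of 0 "b ^ ?n"]) auto
    qed auto
  qed
  then show ?thesis
    using emb unfolding sobolev_into_vanishing_campanato_uniformly_def f_def g_def by simp
qed

section \<open>The optimal Campanato target and the criterion for uniform vanishing\<close>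

theorem theorem3p1:
  fixes s :: real
  assumes "0 < s" and "s < 1"
  shows "\<exists>c>0. \<forall>A. young_function A \<longrightarrow>
     sobolev_into_campanato TYPE('n::finite) s A (phi_sA CARD('n) s A) \<and>
     (\<forall>u \<in> (frac_orlicz_sobolev s A :: (real^'n \<Rightarrow> real) set).
        campanato_seminorm (phi_sA CARD('n) s A) u \<le> ennreal c * frac_seminorm s A u) \<and>
     (\<forall>\<phi>. admissible \<phi> \<longrightarrow> sobolev_into_campanato TYPE('n) s A \<phi> \<longrightarrow>
        campanato_into_campanato TYPE('n) (phi_sA CARD('n) s A) \<phi>) \<and>
     (\<forall>\<phi>. admissible \<phi> \<longrightarrow>
        (sobolev_into_vanishing_campanato_uniformly TYPE('n) s A \<phi> \<longleftrightarrow>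
         (\<exists>C>0. \<forall>r>0. phi_sA CARD('n) s A r \<le> C * \<phi> r) \<and>
         ((\<lambda>r. phi_sA CARD('n) s A r / \<phi> r) \<longlongrightarrow> 0) (at_right 0)))"
proof -
  let ?n = "CARD('n)"
  obtain c where c: "0 < c" and le: "\<And>A \<phi> (u :: real^'n \<Rightarrow> real) B q.
      young_function A \<Longrightarrow> u \<in> borel_measurable lebesgue \<Longrightarrow> B \<in> balls \<Longrightarrow> 0 \<le> q \<Longrightarrow>
      0 < \<phi> (measure lebesgue B powr (1 / real ?n)) \<Longrightarrow>
      phi_sA ?n s A (measure lebesgue B powr (1 / real ?n)) \<le> q * \<phi> (measure lebesgue B powr (1 / real ?n)) \<Longrightarrow>
      campanato_osc \<phi> u B \<le> ennreal (c * q) * frac_seminorm s A u"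
    using campanato_osc_le_frac_seminorm[OF assms(1)] by blast
  have osc: "campanato_osc \<phi> u B \<le> ennreal (c * C) * frac_seminorm s A u"
    if "young_function A" "\<And>r. 0 < r \<Longrightarrow> 0 < \<phi> r" "\<And>r. 0 < r \<Longrightarrow> phi_sA ?n s A r \<le> C * \<phi> r" "0 < C"
      "u \<in> frac_orlicz_sobolev s A" "B \<in> balls"
    for A \<phi> C and u :: "real^'n \<Rightarrow> real" and B
    using that balls_measure_pos[of B] by (intro le) (auto simp: frac_orlicz_sobolev_def)
  have pos: "0 < \<phi> r" if "admissible \<phi>" "0 < r" for \<phi> r
    using that by (simp add: admissible_def)
  have "sobolev_into_campanato TYPE('n) s A (phi_sA ?n s A) \<and>
     (\<forall>u \<in> (frac_orlicz_sobolev s A :: (real^'n \<Rightarrow> real) set).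
        campanato_seminorm (phi_sA ?n s A) u \<le> ennreal c * frac_seminorm s A u) \<and>
     (\<forall>\<phi>. admissible \<phi> \<longrightarrow> sobolev_into_campanato TYPE('n) s A \<phi> \<longrightarrow>
        campanato_into_campanato TYPE('n) (phi_sA ?n s A) \<phi>) \<and>
     (\<forall>\<phi>. admissible \<phi> \<longrightarrow>
        (sobolev_into_vanishing_campanato_uniformly TYPE('n) s A \<phi> \<longleftrightarrow>
         (\<exists>C>0. \<forall>r>0. phi_sA ?n s A r \<le> C * \<phi> r) \<and>
         ((\<lambda>r. phi_sA ?n s A r / \<phi> r) \<longlongrightarrow> 0) (at_right 0)))"
    if A: "young_function A" for A
  proof (intro conjI allI impI ballI)
    \<comment> \<open>Comparing \<open>phi_sA\<close> with itself, with factor 1, leaves exactly the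
      constant \<open>c\<close>, which was fixed before \<open>A\<close>.\<close>
    have osc1: "campanato_osc (phi_sA ?n s A) u B \<le> ennreal c * frac_seminorm s A u"
      if "u \<in> frac_orlicz_sobolev s A" "B \<in> balls" for u :: "real^'n \<Rightarrow> real" and B
      using osc[OF A, of "phi_sA ?n s A" 1 u B] phi_sA_pos[OF A] that by simp
    show "sobolev_into_campanato TYPE('n) s A (phi_sA ?n s A)"
      by (rule sobolev_into_campanatoI(1)[OF A assms(1) c osc1])
    show "campanato_seminorm (phi_sA ?n s A) u \<le> ennreal c * frac_seminorm s A u"
      if "u \<in> frac_orlicz_sobolev s A" for u :: "real^'n \<Rightarrow> real"
      using sobolev_into_campanatoI(2)[OF A assms(1) c osc1] that by blast
  next
    fix \<phi> assume "admissible \<phi>" "sobolev_into_campanato TYPE('n) s A \<phi>"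
    then obtain C where "0 < C" "\<And>r. 0 < r \<Longrightarrow> phi_sA ?n s A r \<le> C * \<phi> r"
      using phi_sA_le_of_embedding[OF assms A] pos by blast
    then show "campanato_into_campanato TYPE('n) (phi_sA ?n s A) \<phi>"
      using \<open>admissible \<phi>\<close> pos A by (intro campanato_into_campanatoI) (auto intro: phi_sA_pos)
  next
    fix \<phi> assume "admissible \<phi>"
    note \<phi> = pos[OF this]
    have emb_iff: "sobolev_into_campanato TYPE('n) s A \<phi> \<longleftrightarrow> (\<exists>C>0. \<forall>r>0. phi_sA ?n s A r \<le> C * \<phi> r)"
    proof
      assume "\<exists>C>0. \<forall>r>0. phi_sA ?n s A r \<le> C * \<phi> r"
      then obtain C where C: "0 < C" "\<And>r. 0 < r \<Longrightarrow> phi_sA ?n s A r \<le> C * \<phi> r" by blast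
      show "sobolev_into_campanato TYPE('n) s A \<phi>"
        by (rule sobolev_into_campanatoI(1)[OF A assms(1), of "c * C"]) (use c C osc[OF A \<phi> C(2,1)] in auto)
    qed (rule phi_sA_le_of_embedding[OF assms A \<phi>])
    show "sobolev_into_vanishing_campanato_uniformly TYPE('n) s A \<phi> \<longleftrightarrow>
         (\<exists>C>0. \<forall>r>0. phi_sA ?n s A r \<le> C * \<phi> r) \<and>
         ((\<lambda>r. phi_sA ?n s A r / \<phi> r) \<longlongrightarrow> 0) (at_right 0)"
    \<comment> \<open>Without the embedding both sides fail, the right one because of
      \<open>emb_iff\<close>; with it only the limit remains to be compared.\<close>
    proof (cases "sobolev_into_campanato TYPE('n) s A \<phi>")
      case True
      then show ?thesis using uniform_vanishing_iff[OF assms A \<phi> True] emb_iff by blast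
    next
      case False
      then show ?thesis
        using emb_iff by (auto simp: sobolev_into_vanishing_campanato_uniformly_def)
    qed
  qed
  with c show ?thesis by blast
qed

end
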